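(* The following statements hold: (1) If $h\in\mathrm{SS}(\mathbb R)$ and $h^{-1}$ is uniformly continuous on $\mathbb R$, then $h^{-1}\in\mathrm{SS}(\mathbb R)$. (2) If $g,h\in\mathrm{SS}(\mathbb R)$ and $h,h^{-1}$ are uniformly continuous on $\mathbb R$, then $g\circ h\in\mathrm{SS}(\mathbb R)$. (3) The set of elements $h\in\mathrm{SS}(\mathbb R)$ such that both $h$ and $h^{-1}$ are uniformly continuous on $\mathbb R$ is a subgroup (under composition) of $\mathrm{SQS}(\mathbb R)$.
   Context: A weight is a locally integrable non-negative measurable function $\omega$ on $\mathbb R$. It is an $A_\infty$-weight if there are constants $C,\alpha>0$ such that $\frac{\int_E\omega\,dx}{\int_I\omega\,dx}\le C\left(\frac{|E|}{|I|}\right)^{\alpha}$ for every bounded closed interval $I\subset\mathbb R$ and every measurable $E\subset I$. A locally integrable function $u$ on $\mathbb R$ is in $\mathrm{BMO}(\mathbb R)$ if $\sup_I \frac1{|I|}\int_I|u-u_I|\,dx<\infty$ (supremum over bounded intervals, $u_I$ the mean of $u$ over $I$), and in $\mathrm{VMO}(\mathbb R)$ if in addition $\frac1{|I|}\int_I|u-u_I|\,dx\to0$ as $|I|\to0$ (uniformly in $I$). $\mathrm{SQS}(\mathbb R)$ is the set of increasing homeomorphisms $h$ of $\mathbb R$ onto itself that are locally absolutely continuous with $h'$ an $A_\infty$-weight; it is known to be a group under composition. $\mathrm{SS}(\mathbb R)$ is the set of $h\in\mathrm{SQS}(\mathbb R)$ with $\log h'\in\mathrm{VMO}(\mathbb R)$.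 *)

theory Defs
  imports "HOL-Analysis.Analysis" "HOL-Algebra.Group"
begin

text \<open>
  Bounded intervals are represented by their end points \<open>a < b\<close>; whether the end points belong
  to the interval is irrelevant for the integrals below. Measurability is with respect to the
  Lebesgue sigma-algebra.
\<close>

definition locally_integrable :: "(real \<Rightarrow> real) \<Rightarrow> bool" where
  "locally_integrable u \<longleftrightarrow> (\<forall>a b. set_integrable lebesgue {a..b} u)"

definition is_weight :: "(real \<Rightarrow> real) \<Rightarrow> bool" where
  "is_weight w \<longleftrightarrow> w \<in> borel_measurable lebesgue \<and> locally_integrable w \<and> (\<forall>x. 0 \<le> w x)"

text \<open>
  The positivity conjunct says that the quotient in the defining inequality makes sense: in HOL,
  division by zero yields zero, so without it the zero function would qualify.
\<close>

definition A_infinity_weight :: "(real \<Rightarrow> real) \<Rightarrow> bool" where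
  "A_infinity_weight w \<longleftrightarrow> is_weight w \<and>
     (\<forall>a b. a < b \<longrightarrow> 0 < (LINT x:{a..b}|lebesgue. w x)) \<and>
     (\<exists>C \<alpha>. 0 < C \<and> 0 < \<alpha> \<and>
        (\<forall>a b E. a < b \<and> E \<in> sets lebesgue \<and> E \<subseteq> {a..b} \<longrightarrow>
           (LINT x:E|lebesgue. w x) / (LINT x:{a..b}|lebesgue. w x)
             \<le> C * (measure lebesgue E / (b - a)) powr \<alpha>))"

definition interval_mean :: "(real \<Rightarrow> real) \<Rightarrow> real \<Rightarrow> real \<Rightarrow> real" where
  "interval_mean u a b = (1 / (b - a)) * (LINT x:{a..b}|lebesgue. u x)"

definition mean_oscillation :: "(real \<Rightarrow> real) \<Rightarrow> real \<Rightarrow> real \<Rightarrow> real" where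
  "mean_oscillation u a b =
     (1 / (b - a)) * (LINT x:{a..b}|lebesgue. \<bar>u x - interval_mean u a b\<bar>)"

definition BMO :: "(real \<Rightarrow> real) set" where
  "BMO = {u. locally_integrable u \<and> bdd_above {mean_oscillation u a b | a b. a < b}}"

definition VMO :: "(real \<Rightarrow> real) set" where
  "VMO = {u \<in> BMO. \<forall>\<epsilon>>0. \<exists>\<delta>>0. \<forall>a b. a < b \<and> b - a < \<delta> \<longrightarrow> mean_oscillation u a b < \<epsilon>}"

definition abs_continuous_on_interval :: "real \<Rightarrow> real \<Rightarrow> (real \<Rightarrow> real) \<Rightarrow> bool" where
  "abs_continuous_on_interval a b h \<longleftrightarrow>
     (\<forall>\<epsilon>>0. \<exists>\<delta>>0. \<forall>(n::nat) s t.
        (\<forall>i<n. a \<le> s i \<and> s i \<le> t i \<and> t i \<le> b) \<and>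
        disjoint_family_on (\<lambda>i. {s i<..<t i}) {..<n} \<and>
        (\<Sum>i<n. t i - s i) < \<delta>
        \<longrightarrow> (\<Sum>i<n. \<bar>h (t i) - h (s i)\<bar>) < \<epsilon>)"

definition locally_abs_continuous :: "(real \<Rightarrow> real) \<Rightarrow> bool" where
  "locally_abs_continuous h \<longleftrightarrow> (\<forall>a b. abs_continuous_on_interval a b h)"

text \<open>
  The derivative of a locally absolutely continuous function exists only almost everywhere; the
  value \<open>0\<close> at the remaining points is a convention on a null set. (The value of
  \<^const>\<open>deriv\<close> at such points is unspecified and might be negative.)
\<close>

definition ae_deriv :: "(real \<Rightarrow> real) \<Rightarrow> real \<Rightarrow> real" where
  "ae_deriv h x = (if h differentiable (at x) then deriv h x else 0)"

definition increasing_homeo :: "(real \<Rightarrow> real) \<Rightarrow> bool" where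
  "increasing_homeo h \<longleftrightarrow> strict_mono h \<and> homeomorphism UNIV UNIV h (inv_into UNIV h)"

definition SQS :: "(real \<Rightarrow> real) set" where
  "SQS = {h. increasing_homeo h \<and> locally_abs_continuous h \<and> A_infinity_weight (ae_deriv h)}"

definition SS :: "(real \<Rightarrow> real) set" where
  "SS = {h \<in> SQS. (\<lambda>x. ln (ae_deriv h x)) \<in> VMO}"

definition SQS_group :: "(real \<Rightarrow> real) monoid" where
  "SQS_group = \<lparr>carrier = SQS, mult = (\<lambda>g h. g \<circ> h), one = id\<rparr>"

end

theory Submission
  imports Defs
begin

text \<open>
  An increasing homeomorphism \<open>h\<close> of the line belongs to \<open>SQS\<close> exactly if it satisfies a power law
  \<open>|h(E)| / |h(I)| \<le> C (|E| / |I|)\<^sup>\<alpha>\<close> (Radon-Nikodym together with a Vitali covering argument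
  identifies the density of the image measure with the derivative of \<open>h\<close>). Power laws compose. That
  \<open>h\<^sup>-\<^sup>1\<close> inherits one follows from the rising sun lemma: an open set \<open>U\<close> lies in an open set of twice its
  measure, on each component of which \<open>U\<close> fills exactly one half, so that passing from the larger set to
  \<open>U\<close> shrinks the measure of the image under \<open>h\<^sup>-\<^sup>1\<close> by a fixed factor; iterate.

  For \<open>u\<close> in \<open>VMO\<close>, Chebyshev's inequality on \<open>h(I)\<close> and the power law of \<open>h\<^sup>-\<^sup>1\<close> bound the measure of
  \<open>{x \<in> I. |u(h x) - c| > \<lambda>}\<close> by \<open>|I| / 16\<close>. By the John-Nirenberg argument, again based on the rising
  sun lemma, such weak bounds for all short intervals control the mean oscillation of \<open>u \<circ> h\<close>, and uniform
  continuity of \<open>h\<close> makes \<open>h(I)\<close> short when \<open>I\<close> is. The claims follow from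
  \<open>log (g \<circ> h)' = log g' \<circ> h + log h'\<close> and \<open>log (h\<^sup>-\<^sup>1)' = - log h' \<circ> h\<^sup>-\<^sup>1\<close> almost everywhere.
\<close>

section \<open>The rising sun lemma\<close>

text \<open>A mean oscillation cannot be carried through \<open>h\<close> directly: the substitution
  brings in the weight of the inverse, which need not be bounded. What does pass through is
  smallness of measure, at the price of the exponent in the power law. Hence oscillation is weakened
  to a level-set bound, moved, and rebuilt into an integral on the other side. There the comparison
  constant is the mean of \<open>u\<close> over \<open>h(I)\<close>, not a mean of the composed
  function, so the John-Nirenberg step has to admit an arbitrary constant for each interval.

  Both stopping arguments use the rising sun lemma because the density on its components is exactly
  1/2; dyadic halving would lose a doubling constant. The price is that components may stick out of
  the given interval on the left, which accounts for the moving left end point in one application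
  and for the separate left piece in the other.

  Power laws are stated for lengths of image sets, since these compose and invert without a chain
  rule. Derivatives enter only through their identification with the density of the image
  measure.\<close>

lemma open_bounded_interval_components:
  fixes G :: "real set"
  assumes "open G" and no_ray: "\<And>x. \<exists>y>x. y \<notin> G" "\<And>x. \<exists>y<x. y \<notin> G"
  obtains \<D> where "countable \<D>" "disjoint \<D>" "\<Union>\<D> = G"
    "\<And>D. D \<in> \<D> \<Longrightarrow> \<exists>p q. p < q \<and> D = {p<..<q} \<and> p \<notin> G \<and> q \<notin> G"
proof
  show "disjoint (components G)"
    using pairwise_disjoint_components[of G] by (simp add: disjnt_def pairwise_def)
  have op: "open D" if "D \<in> components G" for D
    using open_components[OF \<open>open G\<close> that] .
  then show "countable (components G)"
    using countable_disjoint_open_subsets[of "components G"] pairwise_disjoint_components[of G]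
    by (simp add: pairwise_def disjnt_def)
  show "\<Union>(components G) = G" by simp
  fix D assume D: "D \<in> components G"
  have conn: "connected D" and ne: "D \<noteq> {}" and sub: "D \<subseteq> G"
    using in_components_connected[OF D] in_components_nonempty[OF D] in_components_subset[OF D] by auto
  obtain z where z: "z \<in> D" using ne by auto
  have iv: "u \<in> D" if "x \<in> D" "y \<in> D" "x \<le> u" "u \<le> y" for x y u
    using conn that unfolding is_interval_connected_1[symmetric] is_interval_1 by blast
  obtain y1 where y1: "y1 > z" "y1 \<notin> G" using no_ray(1) by blast
  obtain y0 where y0: "y0 < z" "y0 \<notin> G" using no_ray(2) by blast
  have up: "x < y1" if "x \<in> D" for x
    using iv[OF z that, of y1] y1 sub by force
  have lo: "y0 < x" if "x \<in> D" for x
    using iv[OF that z, of y0] y0 sub by force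
  have bdd: "bdd_above D" "bdd_below D"
    using up lo by (meson bdd_above.I bdd_below.I less_imp_le)+
  define p q where "p = Inf D" and "q = Sup D"
  have pn: "p \<notin> D"
  proof
    assume "p \<in> D"
    then obtain e where "e > 0" "\<And>y. dist y p < e \<Longrightarrow> y \<in> D"
      using op[OF D] unfolding open_dist by blast
    then have "p - e/2 \<in> D" by (simp add: dist_real_def)
    then have "p \<le> p - e/2" unfolding p_def by (intro cInf_lower bdd)
    then show False using \<open>e > 0\<close> by simp
  qed
  have qn: "q \<notin> D"
  proof
    assume "q \<in> D"
    then obtain e where "e > 0" "\<And>y. dist y q < e \<Longrightarrow> y \<in> D"
      using op[OF D] unfolding open_dist by blast
    then have "q + e/2 \<in> D" by (simp add: dist_real_def)
    then have "q + e/2 \<le> q" unfolding q_def by (intro cSup_upper bdd)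
    then show False using \<open>e > 0\<close> by simp
  qed
  have eq: "D = {p<..<q}"
  proof
    show "D \<subseteq> {p<..<q}"
    proof
      fix x assume x: "x \<in> D"
      then have "p \<le> x" "x \<le> q" unfolding p_def q_def by (auto intro: cInf_lower cSup_upper bdd)
      then show "x \<in> {p<..<q}" using pn qn x by (metis greaterThanLessThan_iff less_eq_real_def)
    qed
    show "{p<..<q} \<subseteq> D"
    proof
      fix x assume "x \<in> {p<..<q}"
      then obtain a b where "a \<in> D" "a < x" "b \<in> D" "x < b"
        unfolding p_def q_def using cInf_less_iff[OF ne bdd(2)] less_cSup_iff[OF ne bdd(1)] by auto
      then show "x \<in> D" using iv[of a b x] by simp
    qed
  qed
  have pq: "p < q" using eq ne by auto
  \<comment> \<open>Otherwise \<open>p\<close> could be adjoined to \<open>D\<close> and the result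
    would still be a connected subset of \<open>G\<close>, against the maximality of a component.
    The same holds for \<open>q\<close>.\<close>
  have pG: "p \<notin> G"
  proof
    assume "p \<in> G"
    have "connected (insert p D)"
      by (rule connected_intermediate_closure[OF conn]) (use pq eq in auto)
    then have "insert p D \<subseteq> D"
      by (rule components_maximal[OF D]) (use \<open>p \<in> G\<close> sub ne in auto)
    then show False using pn by auto
  qed
  have qG: "q \<notin> G"
  proof
    assume "q \<in> G"
    have "connected (insert q D)"
      by (rule connected_intermediate_closure[OF conn]) (use pq eq in auto)
    then have "insert q D \<subseteq> D"
      by (rule components_maximal[OF D]) (use \<open>q \<in> G\<close> sub ne in auto)
    then show False using qn by auto
  qed
  show "\<exists>p q. p < q \<and> D = {p<..<q} \<and> p \<notin> G \<and> q \<notin> G"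
    using pq eq pG qG by blast
qed

lemma emeasure_le_by_disjoint_cover:
  assumes sets: "sets N = sets M" and \<D>: "countable \<D>" "disjoint \<D>" "\<And>D. D \<in> \<D> \<Longrightarrow> D \<in> sets M"
    and A: "A \<in> sets M" "A \<subseteq> \<Union>\<D>" and B: "B \<in> sets M"
    and le: "\<And>D. D \<in> \<D> \<Longrightarrow> emeasure M (A \<inter> D) \<le> c * emeasure N (B \<inter> D)"
  shows "emeasure M A \<le> c * emeasure N B"
proof -
  have disj: "disjoint_family_on (\<lambda>D. X \<inter> D) \<D>" for X
    using \<D>(2) by (auto simp: disjoint_family_on_def disjoint_def)
  have "emeasure M A = emeasure M (\<Union>D\<in>\<D>. A \<inter> D)"
    using A(2) by (intro arg_cong[where f="emeasure M"]) auto
  also have "\<dots> = (\<integral>\<^sup>+D. emeasure M (A \<inter> D) \<partial>count_space \<D>)"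
    using \<D> A disj by (intro emeasure_UN_countable) auto
  also have "\<dots> \<le> (\<integral>\<^sup>+D. c * emeasure N (B \<inter> D) \<partial>count_space \<D>)"
    using le by (intro nn_integral_mono) auto
  also have "\<dots> = c * (\<integral>\<^sup>+D. emeasure N (B \<inter> D) \<partial>count_space \<D>)"
    by (rule nn_integral_cmult) simp
  also have "(\<integral>\<^sup>+D. emeasure N (B \<inter> D) \<partial>count_space \<D>) = emeasure N (\<Union>D\<in>\<D>. B \<inter> D)"
    using \<D> B disj sets by (intro emeasure_UN_countable[symmetric]) auto
  also have "c * \<dots> \<le> c * emeasure N B"
    using B sets by (intro mult_left_mono emeasure_mono) auto
  finally show ?thesis .
qed

text \<open>The lemma of F. Riesz for the function \<open>\<Phi>\<close>, whose slope is 1/2 on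
  \<open>U\<close> and almost everywhere -1/2 off it. Its graph is the landscape and
  \<open>G\<close> the part in the shade of a sun rising at the far right. The ground has equal
  height at both ends of a component of the shade, and equal heights mean that \<open>U\<close>
  fills exactly half of the component.\<close>

lemma rising_sun:
  fixes U :: "real set"
  assumes U: "open U" "U \<subseteq> {a<..<b}"
  obtains G \<D> where "open G" "U \<subseteq> G" "countable \<D>" "disjoint \<D>" "\<Union>\<D> = G" "G \<subseteq> {..<b}"
    "\<And>D. D \<in> \<D> \<Longrightarrow> \<exists>p q. p < q \<and> D = {p<..<q} \<and> measure lborel (U \<inter> D) = (q - p) / 2"
    "emeasure lborel G = 2 * emeasure lborel U"
proof -
  define m where "m x = measure lborel (U \<inter> {..x})" for x
  define \<Phi> where "\<Phi> x = m x - x / 2" for x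
  have Ub: "U \<in> sets lborel" using U by auto
  have fm: "U \<inter> X \<in> fmeasurable lborel" if "X \<in> sets lborel" for X
    by (rule fmeasurableI2[of "{a..b}"])
       (use U Ub that in \<open>auto simp: fmeasurable_def emeasure_lborel_Icc_eq\<close>)
  have fU: "U \<in> fmeasurable lborel" using fm[of UNIV] by simp
  have mdiff: "m y - m x = measure lborel (U \<inter> {x<..y})" if "x \<le> y" for x y
  proof -
    have "U \<inter> {..y} = (U \<inter> {..x}) \<union> (U \<inter> {x<..y})" using that by auto
    moreover have "measure lborel ((U \<inter> {..x}) \<union> (U \<inter> {x<..y})) =
        measure lborel (U \<inter> {..x}) + measure lborel (U \<inter> {x<..y})"
    proof (rule measure_Union)
      show "emeasure lborel (U \<inter> {..x}) \<noteq> \<infinity>" "emeasure lborel (U \<inter> {x<..y}) \<noteq> \<infinity>"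
        using fm[of "{..x}"] fm[of "{x<..y}"] fmeasurableD2 by force+
      show "U \<inter> {..x} \<inter> (U \<inter> {x<..y}) = {}" by auto
    qed (use Ub in auto)
    ultimately have "m y = m x + measure lborel (U \<inter> {x<..y})"
      unfolding m_def by simp
    then show ?thesis by simp
  qed
  have m_lip: "m y - m x \<le> y - x" "0 \<le> m y - m x" if "x \<le> y" for x y
  proof -
    have "measure lborel (U \<inter> {x<..y}) \<le> measure lborel {x<..y}"
      using that Ub by (intro measure_mono_fmeasurable) (auto simp: fmeasurable_def)
    then show "m y - m x \<le> y - x" using that by (simp add: mdiff)
    show "0 \<le> m y - m x" using that by (simp add: mdiff)
  qed
  have lip: "\<bar>\<Phi> y - \<Phi> x\<bar> \<le> \<bar>y - x\<bar>" for x y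
    using m_lip[of x y] m_lip[of y x] unfolding \<Phi>_def by (cases "x \<le> y") (auto simp: field_simps)
  have cont: "continuous_on X \<Phi>" for X
  proof -
    have "1-lipschitz_on X \<Phi>" using lip by (auto simp: lipschitz_on_def dist_real_def)
    then show ?thesis by (rule lipschitz_on_continuous_on)
  qed
  define G where "G = {x. \<exists>y>x. \<Phi> y > \<Phi> x}"
  have openG: "open G"
  proof -
    have "G = (\<Union>y. {x. x < y} \<inter> {x. \<Phi> x < \<Phi> y})" unfolding G_def by auto
    moreover have "open {x. \<Phi> x < \<Phi> y}" for y
      using cont[of UNIV] by (intro open_Collect_less continuous_on_const)
    moreover have "open {x. x < y}" for y :: real
      by (simp add: open_Collect_less continuous_on_const continuous_on_id)
    ultimately show ?thesis by auto
  qed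
  \<comment> \<open>Beyond \<open>b\<close> nothing is left of \<open>U\<close>, so
    \<open>\<Phi>\<close> falls with slope -1/2 and no point there is in the shade.\<close>
  have right: "\<Phi> y < \<Phi> x" if "b \<le> x" "x < y" for x y
  proof -
    have "U \<inter> {x<..y} = {}" using U that by auto
    then have "m y - m x = 0" using mdiff[of x y] that by simp
    then show ?thesis using that unfolding \<Phi>_def by simp
  qed
  have Gb: "G \<subseteq> {..<b}"
    unfolding G_def using right by (force simp: not_le[symmetric])
  have UG: "U \<subseteq> G"
  proof
    fix x assume "x \<in> U"
    then obtain e where "e > 0" "ball x e \<subseteq> U" using U by (meson openE)
    then have sub: "{x<..x+e/2} \<subseteq> U" by (auto simp: subset_eq dist_real_def)
    then have "U \<inter> {x<..x+e/2} = {x<..x+e/2}" by auto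
    then have "m (x+e/2) - m x = e/2" using mdiff[of x "x+e/2"] \<open>e > 0\<close> by simp
    then have "\<Phi> (x+e/2) > \<Phi> x" using \<open>e > 0\<close> unfolding \<Phi>_def by (simp add: field_simps)
    then show "x \<in> G" unfolding G_def using \<open>e > 0\<close> by (intro CollectI exI[of _ "x+e/2"]) auto
  qed
  have ray1: "\<exists>y>x. y \<notin> G" for x using Gb by (intro exI[of _ "max b (x+1)"]) auto
  have m_bound: "0 \<le> m x" "m x \<le> measure lborel U" for x
    unfolding m_def using fm fU by (auto intro!: measure_mono_fmeasurable)
  \<comment> \<open>To the left of a point \<open>q\<close> outside \<open>G\<close>, the maximum of \<open>\<Phi>\<close> over \<open>[x, q]\<close> sits at \<open>q\<close>
    as soon as \<open>[x, q)\<close> lies in \<open>G\<close>.\<close>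
  have max_at_end: "\<Phi> x \<le> \<Phi> q" if "x \<le> q" "{x..<q} \<subseteq> G" "q \<notin> G" for x q
  proof -
    have "\<exists>z\<in>{x..q}. \<forall>y\<in>{x..q}. \<Phi> y \<le> \<Phi> z"
      using that by (intro continuous_attains_sup cont) auto
    then obtain z where z: "z \<in> {x..q}" "\<And>y. y \<in> {x..q} \<Longrightarrow> \<Phi> y \<le> \<Phi> z" by blast
    have "z = q"
    proof (rule ccontr)
      assume "z \<noteq> q"
      then have "z \<in> G" using z that by auto
      then obtain y where y: "y > z" "\<Phi> y > \<Phi> z" unfolding G_def by auto
      then have "y > q" using z(1) z(2)[of y] by force
      moreover have "\<Phi> q \<le> \<Phi> z" using z that by auto
      ultimately have "q \<in> G" unfolding G_def using y by auto
      then show False using that by simp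
    qed
    then show ?thesis using z that by auto
  qed
  \<comment> \<open>Towards the left \<open>\<Phi>\<close> grows without bound, whereas on a left
    ray inside \<open>G\<close> it would be bounded by its value at the right end \<open>q\<close>
    of the ray.\<close>
  have ray2: "\<exists>y<x. y \<notin> G" for x
  proof (rule ccontr)
    assume "\<not> ?thesis"
    then have all: "y \<in> G" if "y < x" for y using that by auto
    define Q where "Q = {y. x \<le> y \<and> y \<notin> G}"
    have "Q \<noteq> {}" using ray1[of x] unfolding Q_def by (auto intro: less_imp_le)
    moreover have "closed Q"
    proof -
      have "Q = {x..} \<inter> - G" unfolding Q_def by auto
      then show ?thesis using openG by auto
    qed
    moreover have bdd: "bdd_below Q" unfolding Q_def by (auto intro: bdd_belowI[of _ x])
    ultimately have q: "Inf Q \<in> Q" by (intro closed_contains_Inf)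
    define q where "q = Inf Q"
    have qq: "q \<notin> G" "x \<le> q" using q unfolding q_def Q_def by auto
    have sub: "y \<in> G" if "y < q" for y
      using all[of y] that cInf_lower[OF _ bdd, of y] unfolding q_def[symmetric]
      by (auto simp: Q_def not_le[symmetric])
    \<comment> \<open>Far enough left for \<open>- y/2\<close> to exceed the bound
      \<open>measure lborel U - q/2\<close> on \<open>\<Phi> q\<close> by one.\<close>
    define y where "y = q - 2 * measure lborel U - 2"
    have "y \<le> q" unfolding y_def using measure_nonneg[of lborel U] by linarith
    then have "\<Phi> y \<le> \<Phi> q" by (intro max_at_end) (use sub qq in auto)
    moreover have "\<Phi> y \<ge> - y/2" "\<Phi> q \<le> measure lborel U - q/2"
      using m_bound[of y] m_bound[of q] unfolding \<Phi>_def by auto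
    ultimately have "- y/2 \<le> measure lborel U - q/2" by linarith
    then show False unfolding y_def by simp
  qed
  obtain \<D> where \<D>: "countable \<D>" "disjoint \<D>" "\<Union>\<D> = G"
    "\<And>D. D \<in> \<D> \<Longrightarrow> \<exists>p q. p < q \<and> D = {p<..<q} \<and> p \<notin> G \<and> q \<notin> G"
    using open_bounded_interval_components[OF openG ray1 ray2] by metis
  have half: "\<exists>p q. p < q \<and> D = {p<..<q} \<and> measure lborel (U \<inter> D) = (q - p) / 2"
    if D: "D \<in> \<D>" for D
  proof -
    obtain p q where pq: "p < q" "D = {p<..<q}" "p \<notin> G" "q \<notin> G" using \<D>(4)[OF D] by auto
    have subG: "{p<..<q} \<subseteq> G" using \<D>(3) D pq by auto
    have "\<not> \<Phi> q > \<Phi> p" using pq(1,3) unfolding G_def by blast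
    \<comment> \<open>Since \<open>p\<close> lies outside \<open>G\<close>,
      \<open>max_at_end\<close> reaches only points to the right of \<open>p\<close>; continuity
      covers \<open>p\<close> itself.\<close>
    moreover have "\<Phi> p \<le> \<Phi> q"
    proof -
      have "\<Phi> x \<le> \<Phi> q" if "x \<in> {p<..<q}" for x
        by (rule max_at_end) (use that subG pq in auto)
      moreover have "closure {p<..<q} = {p..q}" using pq by simp
      ultimately show ?thesis
        using continuous_le_on_closure[where S="{p<..<q}" and f=\<Phi> and x=p and a="\<Phi> q", OF cont] pq by simp
    qed
    ultimately have "m q - m p = (q - p) / 2" unfolding \<Phi>_def by (simp add: field_simps)
    moreover have "U \<inter> {p<..q} = U \<inter> D" using UG pq by (auto simp: less_le)
    ultimately show ?thesis using mdiff[of p q] pq by (intro exI[of _ p] exI[of _ q]) auto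
  qed
  have D_borel: "D \<in> sets lborel" if "D \<in> \<D>" for D using \<D>(4)[OF that] by auto
  have emD: "emeasure lborel D = 2 * emeasure lborel (U \<inter> D)" if D: "D \<in> \<D>" for D
  proof -
    obtain p q where pq: "p < q" "D = {p<..<q}" "measure lborel (U \<inter> D) = (q - p) / 2"
      using half[OF D] by auto
    have "emeasure lborel (U \<inter> D) = ennreal ((q - p) / 2)"
      using emeasure_eq_measure2[OF fm[OF D_borel[OF D]]] pq(3) by (simp only:)
    moreover have two: "2 * ((q - p) / 2) = q - p" by simp
    have "ennreal (q - p) = ennreal 2 * ennreal ((q - p) / 2)"
      using ennreal_mult[of 2 "(q - p) / 2"] pq unfolding two by simp
    ultimately show ?thesis using pq by simp
  qed
  have "emeasure lborel G \<le> 2 * emeasure lborel U"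
    by (rule emeasure_le_by_disjoint_cover[OF _ \<D>(1,2)])
       (use D_borel \<D>(3) openG Ub emD in \<open>auto simp: Int_absorb2 Int_absorb1 Sup_upper Int_commute\<close>)
  moreover have "2 * emeasure lborel U \<le> emeasure lborel G"
  proof -
    have "emeasure lborel U \<le> ennreal (1/2) * emeasure lborel G"
    proof (rule emeasure_le_by_disjoint_cover[OF _ \<D>(1,2)])
      fix D assume D: "D \<in> \<D>"
      then have "G \<inter> D = D" using \<D>(3) by auto
      moreover have "ennreal (1/2) * (2 * x) = x" for x
      proof -
        have "ennreal (1/2) * (2 * x) = (ennreal (1/2) * ennreal 2) * x" by (simp add: mult.assoc)
        also have "ennreal (1/2) * ennreal 2 = 1" by (subst ennreal_mult[symmetric]) auto
        finally show ?thesis by simp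
      qed
      ultimately show "emeasure lborel (U \<inter> D) \<le> ennreal (1/2) * emeasure lborel (G \<inter> D)"
        by (simp add: emD[OF D])
    qed (use D_borel \<D>(3) openG Ub UG in auto)
    then have "2 * emeasure lborel U \<le> 2 * (ennreal (1/2) * emeasure lborel G)"
      by (intro mult_left_mono) auto
    also have "\<dots> = (ennreal 2 * ennreal (1/2)) * emeasure lborel G" by (simp add: mult.assoc)
    also have "ennreal 2 * ennreal (1/2) = 1" by (subst ennreal_mult[symmetric]) auto
    finally show ?thesis by simp
  qed
  ultimately show ?thesis using that[OF openG UG \<D>(1-3) Gb half] by auto
qed

section \<open>Increasing homeomorphisms and their image measures\<close>

lemma increasing_homeoD:
  assumes "increasing_homeo h"
  shows "strict_mono h" "bij h" "continuous_on UNIV h" "continuous_on UNIV (inv_into UNIV h)"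
    "h (inv_into UNIV h x) = x" "inv_into UNIV h (h x) = x"
proof -
  have hom: "homeomorphism UNIV UNIV h (inv_into UNIV h)" and sm: "strict_mono h"
    using assms by (auto simp: increasing_homeo_def)
  show "strict_mono h" by fact
  show "h (inv_into UNIV h x) = x" "inv_into UNIV h (h x) = x" "continuous_on UNIV h" "continuous_on UNIV (inv_into UNIV h)"
    using hom by (auto simp: homeomorphism_def)
  show "bij h"
    using hom sm by (auto simp: homeomorphism_def bij_def strict_mono_imp_inj_on)
qed

lemma increasing_homeo_inv:
  assumes "increasing_homeo h"
  shows "increasing_homeo (inv_into UNIV h)" "inv_into UNIV (inv_into UNIV h) = h"
proof -
  note D = increasing_homeoD[OF assms]
  show eq: "inv_into UNIV (inv_into UNIV h) = h" using D(2) by (rule inv_inv_eq)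
  have "strict_mono (inv_into UNIV h)"
    using D(1,5) by (metis strict_mono_less strict_monoI)
  then show "increasing_homeo (inv_into UNIV h)"
    using assms eq by (auto simp: increasing_homeo_def homeomorphism_symD)
qed

lemma increasing_homeo_comp:
  assumes "increasing_homeo g" "increasing_homeo h"
  shows "increasing_homeo (g \<circ> h)" "inv_into UNIV (g \<circ> h) = inv_into UNIV h \<circ> inv_into UNIV g"
proof -
  show eq: "inv_into UNIV (g \<circ> h) = inv_into UNIV h \<circ> inv_into UNIV g"
    using assms increasing_homeoD(2) by (simp add: o_inv_distrib)
  show "increasing_homeo (g \<circ> h)"
    using assms homeomorphism_compose[of UNIV UNIV h "inv_into UNIV h" UNIV g "inv_into UNIV g"]
    unfolding increasing_homeo_def eq by (auto simp: strict_mono_def)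
qed

lemma increasing_homeo_id: "increasing_homeo id"
  by (auto simp: increasing_homeo_def strict_mono_def homeomorphism_def)

context
  fixes h assumes h: "increasing_homeo h"
begin

lemma increasing_homeo_less_iff: "h x < h y \<longleftrightarrow> x < y" "h x \<le> h y \<longleftrightarrow> x \<le> y"
  using increasing_homeoD(1)[OF h] strict_mono_less strict_mono_less_eq by blast+

lemma image_eq_vimage_inv: "h ` A = inv_into UNIV h -` A"
  using increasing_homeoD(5,6)[OF h] by (auto simp: image_iff) metis

lemma image_Icc_Ioo: "h ` {a..b} = {h a..h b}" "h ` {a<..<b} = {h a<..<h b}"
proof -
  have *: "a \<le> inv_into UNIV h x \<longleftrightarrow> h a \<le> x" "inv_into UNIV h x \<le> a \<longleftrightarrow> x \<le> h a"
    "a < inv_into UNIV h x \<longleftrightarrow> h a < x" "inv_into UNIV h x < a \<longleftrightarrow> x < h a" for a x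
    using increasing_homeo_less_iff[of a "inv_into UNIV h x"] increasing_homeo_less_iff[of "inv_into UNIV h x" a]
      increasing_homeoD(5)[OF h] by auto
  show "h ` {a..b} = {h a..h b}" "h ` {a<..<b} = {h a<..<h b}"
    unfolding image_eq_vimage_inv by (auto simp: *)
qed

lemma borel_image: "A \<in> sets borel \<Longrightarrow> h ` A \<in> sets borel"
  unfolding image_eq_vimage_inv
  using measurable_sets[OF borel_measurable_continuous_onI[OF increasing_homeoD(4)[OF h]], of A] by simp

end

text \<open>The Lebesgue-Stieltjes measure of \<open>h\<close>, which assigns to a Borel set the
  length of its image. Written as a push-forward under the inverse, it is a measure by
  construction.\<close>

definition image_measure :: "(real \<Rightarrow> real) \<Rightarrow> real measure" where
  "image_measure h = distr lborel borel (inv_into UNIV h)"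

lemma sets_image_measure [simp, measurable_cong]: "sets (image_measure h) = sets borel"
  and space_image_measure [simp]: "space (image_measure h) = UNIV"
  by (auto simp: image_measure_def)

lemma emeasure_image_measure:
  assumes "increasing_homeo h" "A \<in> sets borel"
  shows "emeasure (image_measure h) A = emeasure lborel (h ` A)"
  unfolding image_measure_def image_eq_vimage_inv[OF assms(1)]
  by (subst emeasure_distr)
     (use borel_measurable_continuous_onI[OF increasing_homeoD(4)[OF assms(1)]] assms(2) in auto)

lemma fmeasurable_lborel_bounded:
  fixes a b :: real
  assumes "A \<in> sets borel" "A \<subseteq> {a..b}"
  shows "A \<in> fmeasurable lborel"
  by (rule fmeasurableI2[of "{a..b}"]) (use assms in \<open>auto simp: fmeasurable_def emeasure_lborel_Icc_eq\<close>)

section \<open>Absolute continuity and null sets\<close>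

lemma measure_disjoint_intervals:
  fixes s t :: "nat \<Rightarrow> real"
  assumes "disjoint_family_on (\<lambda>i. {s i<..<t i}) {..<n}" "\<And>i. i < n \<Longrightarrow> s i \<le> t i"
  shows "measure lborel (\<Union>i<n. {s i<..<t i}) = (\<Sum>i<n. t i - s i)"
proof -
  have "measure lborel (\<Union>i<n. {s i<..<t i}) = (\<Sum>i<n. measure lborel {s i<..<t i})"
    by (rule measure_finite_Union) (use assms in \<open>auto simp: emeasure_lborel_Ioo\<close>)
  then show ?thesis using assms by simp
qed

lemma disjoint_family_on_image:
  assumes "increasing_homeo h" "disjoint_family_on (\<lambda>i. {s i<..<t i}) I"
  shows "disjoint_family_on (\<lambda>i. {h (s i)<..<h (t i)}) I"
proof -
  have inj: "inj h" using increasing_homeoD(2)[OF assms(1)] by (rule bij_is_inj)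
  have "disjoint_family_on (\<lambda>i. h ` {s i<..<t i}) I"
    using assms(2) unfolding disjoint_family_on_def by (simp add: image_Int[OF inj, symmetric])
  then show ?thesis using image_Icc_Ioo(2)[OF assms(1)] by simp
qed

lemma countable_union_finite_chain:
  assumes "countable \<D>"
  shows "\<exists>F :: nat \<Rightarrow> 'a set. (\<forall>n. finite (F n) \<and> F n \<subseteq> \<D>) \<and> incseq F \<and> \<D> = (\<Union>n. F n)"
proof (cases "\<D> = {}")
  case True
  then show ?thesis by (intro exI[of _ "\<lambda>_. {}"]) auto
next
  case False
  show ?thesis
  proof (intro exI[of _ "\<lambda>n. from_nat_into \<D> ` {..<n}"] conjI allI)
    show "from_nat_into \<D> ` {..<n} \<subseteq> \<D>" for n
      using from_nat_into[OF False] by auto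
    show "incseq (\<lambda>n. from_nat_into \<D> ` {..<n})" by (auto simp: incseq_def)
    show "\<D> = (\<Union>n. from_nat_into \<D> ` {..<n})"
      using range_from_nat_into[OF False assms] by auto
  qed auto
qed

text \<open>Absolute continuity speaks of finitely many intervals, while an open set may have
  infinitely many components. The bound for finite unions of components passes to the whole set by
  continuity of the measure from below, where the strict inequality becomes a weak one.\<close>

lemma abs_continuous_image_small:
  assumes h: "increasing_homeo h" and ac: "abs_continuous_on_interval a b h" and "0 < e"
  obtains d where "0 < d"
    "\<And>V. open V \<Longrightarrow> V \<subseteq> {a<..<b} \<Longrightarrow> measure lborel V < d \<Longrightarrow> emeasure lborel (h ` V) \<le> ennreal e"
proof -
  obtain d where "0 < d" and D: "\<forall>(n::nat) s t. (\<forall>i<n. a \<le> s i \<and> s i \<le> t i \<and> t i \<le> b) \<and>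
      disjoint_family_on (\<lambda>i. {s i<..<t i}) {..<n} \<and> (\<Sum>i<n. t i - s i) < d \<longrightarrow>
      (\<Sum>i<n. \<bar>h (t i) - h (s i)\<bar>) < e"
    using ac[unfolded abs_continuous_on_interval_def, rule_format, OF \<open>0 < e\<close>] by (elim exE conjE)
  have d: "(\<Sum>i<n. \<bar>h (t i) - h (s i)\<bar>) < e"
    if "\<And>i. i < n \<Longrightarrow> a \<le> s i \<and> s i \<le> t i \<and> t i \<le> b"
      "disjoint_family_on (\<lambda>i. {s i<..<t i}) {..<n}" "(\<Sum>i<n. t i - s i) < d" for n :: nat and s t
    by (rule D[rule_format]) (use that in auto)
  have "emeasure lborel (h ` V) \<le> ennreal e"
    if V: "open V" "V \<subseteq> {a<..<b}" "measure lborel V < d" for V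
  proof -
    have ray: "\<exists>y>x. y \<notin> V" "\<exists>y<x. y \<notin> V" for x
    proof -
      have "max (x+1) b \<notin> V" "min (x-1) a \<notin> V" using V(2) by auto
      moreover have "x < max (x+1) b" "min (x-1) a < x" by auto
      ultimately show "\<exists>y>x. y \<notin> V" "\<exists>y<x. y \<notin> V" by blast+
    qed
    obtain \<D> where \<D>: "countable \<D>" "disjoint \<D>" "\<Union>\<D> = V"
      "\<And>D. D \<in> \<D> \<Longrightarrow> \<exists>p q. p < q \<and> D = {p<..<q}"
      using open_bounded_interval_components[OF V(1) ray] by metis
    obtain P Q where PQ: "\<And>D. D \<in> \<D> \<Longrightarrow> P D < Q D \<and> {P D<..<Q D} = D"
      using \<D>(4) by metis
    obtain F where F: "\<And>n::nat. finite (F n)" "\<And>n. F n \<subseteq> \<D>" "incseq F" "\<D> = (\<Union>n. F n)"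
      using countable_union_finite_chain[OF \<D>(1)] by metis
    have fin: "emeasure lborel (h ` \<Union>(F n)) \<le> ennreal e" for n
    proof -
      obtain g where g: "bij_betw g {0..<card (F n)} (F n)"
        using ex_bij_betw_nat_finite[OF F(1)] by blast
      let ?N = "card (F n)"
      have gF: "g i \<in> \<D>" "g i \<in> F n" if "i < ?N" for i
        using g that F(2)[of n] by (auto simp: bij_betw_def)
      have disj: "disjoint_family_on (\<lambda>i. {P (g i)<..<Q (g i)}) {..<?N}"
      proof -
        have "g i \<inter> g j = {}" if "i < ?N" "j < ?N" "i \<noteq> j" for i j
        proof -
          have "g i \<noteq> g j" using g that by (auto simp: bij_betw_def inj_on_def)
          then show ?thesis using \<D>(2) gF that by (auto simp: disjoint_def)
        qed
        then show ?thesis using PQ gF by (auto simp: disjoint_family_on_def)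
      qed
      have un: "\<Union>(F n) = (\<Union>i<?N. {P (g i)<..<Q (g i)})"
      proof -
        have "\<Union>(F n) = (\<Union>i<?N. g i)" using g by (auto simp: bij_betw_def atLeast0LessThan)
        also have "\<dots> = (\<Union>i<?N. {P (g i)<..<Q (g i)})" using PQ gF by auto
        finally show ?thesis .
      qed
      have subs: "{P (g i)<..<Q (g i)} \<subseteq> {a<..<b}" if "i < ?N" for i
        using PQ[of "g i"] gF[OF that] \<D>(3) V(2) by auto
      have ab: "a \<le> P (g i)" "P (g i) \<le> Q (g i)" "Q (g i) \<le> b" if "i < ?N" for i
        using subs[OF that] PQ[OF gF(1)[OF that]]
        unfolding greaterThanLessThan_subseteq_greaterThanLessThan by auto
      have "(\<Sum>i<?N. Q (g i) - P (g i)) = measure lborel (\<Union>(F n))"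
        unfolding un by (rule measure_disjoint_intervals[symmetric]) (use disj ab in auto)
      also have "\<dots> \<le> measure lborel V"
      proof (rule measure_mono_fmeasurable)
        show "\<Union>(F n) \<subseteq> V" using F(2)[of n] \<D>(3) by auto
        show "\<Union>(F n) \<in> sets lborel" unfolding un by auto
        show "V \<in> fmeasurable lborel"
          by (rule fmeasurable_lborel_bounded[of _ a b]) (use V in auto)
      qed
      also have "\<dots> < d" by fact
      finally have "(\<Sum>i<?N. \<bar>h (Q (g i)) - h (P (g i))\<bar>) < e"
        by (intro d) (use ab disj in auto)
      also have "(\<Sum>i<?N. \<bar>h (Q (g i)) - h (P (g i))\<bar>) = (\<Sum>i<?N. h (Q (g i)) - h (P (g i)))"
        by (intro sum.cong) (use ab increasing_homeo_less_iff[OF h] in auto)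
      also have "\<dots> = measure lborel (\<Union>i<?N. {h (P (g i))<..<h (Q (g i))})"
        by (rule measure_disjoint_intervals[symmetric])
           (use disjoint_family_on_image[OF h disj] ab increasing_homeo_less_iff[OF h] in auto)
      also have "(\<Union>i<?N. {h (P (g i))<..<h (Q (g i))}) = h ` \<Union>(F n)"
        unfolding un by (simp add: image_UN image_Icc_Ioo[OF h])
      finally have small: "measure lborel (h ` \<Union>(F n)) < e" .
      have "h ` \<Union>(F n) \<in> fmeasurable lborel"
      proof (rule fmeasurable_lborel_bounded[of _ "h a" "h b"])
        show "h ` \<Union>(F n) \<in> sets borel" unfolding un by (intro borel_image[OF h]) auto
        show "h ` \<Union>(F n) \<subseteq> {h a..h b}"
          using subs unfolding un by (force simp: increasing_homeo_less_iff[OF h])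
      qed
      then show ?thesis using small by (simp add: emeasure_eq_measure2 ennreal_leI)
    qed
    have Fb: "h ` \<Union>(F n) \<in> sets borel" for n
    proof (intro borel_image[OF h] borel_open open_Union ballI)
      fix D assume "D \<in> F n"
      then have "D = {P D<..<Q D}" using F(2)[of n] PQ[of D] by auto
      then show "open D" by (metis open_greaterThanLessThan)
    qed
    have inc: "incseq (\<lambda>n. h ` \<Union>(F n))"
      using F(3) unfolding incseq_def by (meson Union_mono image_mono)
    have rng: "range (\<lambda>n. h ` \<Union>(F n)) \<subseteq> sets lborel" using Fb by auto
    have "V = (\<Union>n. \<Union>(F n))" using \<D>(3) F(4) by auto
    then have "h ` V = (\<Union>n. h ` \<Union>(F n))" by (simp add: image_UN)
    then have "emeasure lborel (h ` V) = (SUP n. emeasure lborel (h ` \<Union>(F n)))"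
      using SUP_emeasure_incseq[OF rng inc] by simp
    also have "\<dots> \<le> ennreal e" by (intro SUP_least fin)
    finally show ?thesis .
  qed
  then show thesis using that \<open>0 < d\<close> by blast
qed

text \<open>Lusin's property (N), by outer regularity: inside a bounded window a null set has open
  neighbourhoods of arbitrarily small measure, and their images are small by the previous
  lemma.\<close>

lemma abs_continuous_image_null:
  assumes h: "increasing_homeo h" and ac: "locally_abs_continuous h" and N: "N \<in> null_sets lborel"
  shows "h ` N \<in> null_sets lborel"
proof -
  have Nb: "N \<in> sets borel" "emeasure lborel N = 0" using N by auto
  have part: "h ` (N \<inter> {a<..<b}) \<in> null_sets lborel" for a b
  proof -
    have "emeasure lborel (h ` (N \<inter> {a<..<b})) \<le> 0 + ennreal e" if "e > 0" for e
    proof -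
      obtain d where d: "d > 0" "\<And>V. open V \<Longrightarrow> V \<subseteq> {a<..<b} \<Longrightarrow> measure lborel V < d \<Longrightarrow>
          emeasure lborel (h ` V) \<le> ennreal e"
        using abs_continuous_image_small[OF h _ \<open>e > 0\<close>, of a b] ac
        unfolding locally_abs_continuous_def by metis
      obtain U where U: "open U" "N \<subseteq> U" "emeasure lborel (U - N) < ennreal d"
        using outer_regular_lborel[OF Nb(1) d(1)] by metis
      have "emeasure lborel U \<le> emeasure lborel (U - N) + emeasure lborel N"
        using U Nb by (intro order_trans[OF emeasure_mono emeasure_subadditive]) auto
      then have Ud: "emeasure lborel U < ennreal d" using U(3) Nb(2) by simp
      let ?V = "U \<inter> {a<..<b}"
      have "emeasure lborel ?V < ennreal d"
        using Ud U by (intro le_less_trans[OF emeasure_mono Ud]) auto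
      moreover have "?V \<in> fmeasurable lborel"
        by (rule fmeasurable_lborel_bounded[of _ a b]) (use U in auto)
      ultimately have "measure lborel ?V < d"
        using d(1) by (simp add: emeasure_eq_measure2 ennreal_less_iff)
      then have "emeasure lborel (h ` ?V) \<le> ennreal e" using U by (intro d(2)) auto
      moreover have "emeasure lborel (h ` (N \<inter> {a<..<b})) \<le> emeasure lborel (h ` ?V)"
        using U by (intro emeasure_mono) (auto intro!: borel_image[OF h])
      ultimately show ?thesis by simp
    qed
    then have "emeasure lborel (h ` (N \<inter> {a<..<b})) \<le> 0" by (rule ennreal_le_epsilon)
    then show ?thesis using borel_image[OF h, of "N \<inter> {a<..<b}"] Nb by (simp add: null_sets_def)
  qed
  have "(\<Union>n::nat. h ` (N \<inter> {- real n<..<real n})) \<in> null_sets lborel"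
    using part by (intro null_sets_UN) auto
  moreover have "h ` N = (\<Union>n::nat. h ` (N \<inter> {- real n<..<real n}))"
  proof -
    have "\<exists>n::nat. x \<in> {- real n<..<real n}" for x :: real
    proof -
      obtain n :: nat where "\<bar>x\<bar> < real n" using reals_Archimedean2 by blast
      then show ?thesis by (intro exI[of _ n]) auto
    qed
    then have "N = (\<Union>n::nat. N \<inter> {- real n<..<real n})" by blast
    then have "h ` N = h ` (\<Union>n::nat. N \<inter> {- real n<..<real n})" by (rule arg_cong)
    then show ?thesis by (simp only: image_UN)
  qed
  ultimately show ?thesis by simp
qed

section \<open>Differentiation of the image measure\<close>

lemma null_sets_lborel_iff_negligible:
  fixes A :: "'a::euclidean_space set"
  assumes "A \<in> sets borel"
  shows "A \<in> null_sets lborel \<longleftrightarrow> negligible A"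
  using assms by (simp add: negligible_iff_null_sets null_sets_completion_iff)

lemma vitali_intervals:
  fixes E :: "real set" and P :: "real \<Rightarrow> real \<Rightarrow> bool"
  assumes E: "E \<in> sets borel" and U: "open U" "E \<subseteq> U"
    and fine: "\<And>x d. x \<in> E \<Longrightarrow> 0 < d \<Longrightarrow> \<exists>s t. s < x \<and> x < t \<and> t - s < d \<and> P s t"
  obtains \<D> where "countable \<D>" "disjoint \<D>" "\<Union>\<D> \<subseteq> U"
    "\<forall>D\<in>\<D>. \<exists>s t. s < t \<and> D = {s..t} \<and> P s t"
    "E - \<Union>\<D> \<in> null_sets lborel"
proof -
  define K where "K = {(s, t). s < t \<and> {s..t} \<subseteq> U \<and> P s t}"
  let ?a = "\<lambda>i::real\<times>real. (fst i + snd i) / 2" and ?r = "\<lambda>i::real\<times>real. (snd i - fst i) / 2"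
  have cb: "cball (?a i) (?r i) = {fst i..snd i}" for i
    by (auto simp: cball_eq_atLeastAtMost field_simps)
  have S0: "\<exists>i. i \<in> K \<and> x \<in> cball (?a i) (?r i) \<and> ?r i < d" if xd: "x \<in> E" "0 < d" for x d
  proof -
    obtain e where e: "e > 0" "ball x e \<subseteq> U" using U xd(1) by (meson openE subsetD)
    obtain s t where st: "s < x" "x < t" "t - s < min d e" "P s t"
      using fine[OF xd(1), of "min d e"] xd(2) e(1) by auto
    have "{s..t} \<subseteq> ball x e" using st by (auto simp: dist_real_def)
    then have "(s, t) \<in> K" unfolding K_def using st e by auto
    moreover have "?r (s, t) < d" using st by simp
    ultimately show ?thesis unfolding cb using st by (intro exI[of _ "(s, t)"]) auto
  qed
  have r0: "0 < ?r i" if "i \<in> K" for i using that unfolding K_def by auto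
  obtain C where C: "countable C" "C \<subseteq> K"
    "pairwise (\<lambda>i j. disjnt (cball (?a i) (?r i)) (cball (?a j) (?r j))) C"
    "negligible (E - (\<Union>i\<in>C. cball (?a i) (?r i)))"
    by (rule Vitali_covering_theorem_cballs[of K ?r E ?a, OF r0 S0])
  note C = C[unfolded cb]
  have CK: "fst i < snd i \<and> {fst i..snd i} \<subseteq> U \<and> P (fst i) (snd i)" if "i \<in> C" for i
  proof -
    have "i \<in> K" using that C(2) by auto
    then show ?thesis unfolding K_def by (cases i) simp
  qed
  let ?D = "(\<lambda>i. {fst i..snd i}) ` C"
  show thesis
  proof
    show "countable ?D" using C(1) by simp
    show "disjoint ?D"
      unfolding pairwise_def
    proof (intro ballI impI)
      fix X Y assume XY: "X \<in> ?D" "Y \<in> ?D" "X \<noteq> Y"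
      then obtain i j where ij: "i \<in> C" "X = {fst i..snd i}" "j \<in> C" "Y = {fst j..snd j}" by blast
      then have "i \<noteq> j" using XY(3) by blast
      then show "disjnt X Y" unfolding ij(2,4) using pairwiseD[OF C(3) ij(1,3)] by blast
    qed
    show "\<Union>?D \<subseteq> U" using CK by blast
    have "(\<Union>i\<in>C. {fst i..snd i}) \<in> sets borel"
      by (intro sets.countable_UN'') (use C(1) in auto)
    then show "E - \<Union>?D \<in> null_sets lborel"
      using C(4) E by (subst null_sets_lborel_iff_negligible) auto
    show "\<forall>D\<in>?D. \<exists>s t. s < t \<and> D = {s..t} \<and> P s t"
      using CK by blast
  qed
qed

lemma image_measure_Icc:
  assumes "increasing_homeo h" "s \<le> t"
  shows "emeasure (image_measure h) {s..t} = ennreal (h t - h s)"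
  using assms increasing_homeo_less_iff(2)[OF assms(1), of s t]
  by (simp add: emeasure_image_measure image_Icc_Ioo)

lemma image_measure_outer_open:
  assumes h: "increasing_homeo h" and E: "E \<in> sets borel" and "(e::real) > 0"
  obtains U where "open U" "E \<subseteq> U"
    "emeasure (image_measure h) U \<le> emeasure (image_measure h) E + ennreal e"
proof -
  obtain V where V: "open V" "h ` E \<subseteq> V" "emeasure lborel (V - h ` E) < ennreal e"
    using outer_regular_lborel[OF borel_image[OF h E] \<open>e > 0\<close>] by metis
  let ?U = "h -` V"
  have hU: "h ` ?U = V" using increasing_homeoD(2)[OF h] by (simp add: bij_is_surj surj_image_vimage_eq)
  have U: "open ?U" using V(1) increasing_homeoD(3)[OF h] by (simp add: open_vimage)
  have "emeasure lborel V = emeasure lborel (h ` E \<union> (V - h ` E))"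
    using V(2) by (intro arg_cong[where f="emeasure lborel"]) auto
  also have "\<dots> \<le> emeasure lborel (h ` E) + emeasure lborel (V - h ` E)"
    using V(1) borel_image[OF h E] by (intro emeasure_subadditive) auto
  also have "\<dots> \<le> emeasure lborel (h ` E) + ennreal e"
    using V(3) by (intro add_left_mono) simp
  finally have "emeasure lborel (h ` ?U) \<le> emeasure lborel (h ` E) + ennreal e" unfolding hU .
  then show thesis
    using that[OF U] V(2) E U by (auto simp: emeasure_image_measure[OF h])
qed

text \<open>Disjoint intervals of slope above \<open>q\<close>, chosen inside an open set whose
  image measure is close to that of \<open>E\<close>, cover \<open>E\<close> up to a null set. The
  inequality holds on each of them and adds up.\<close>

lemma measure_le_image_measure_of_large_slopes:
  assumes h: "increasing_homeo h" and E: "E \<in> sets borel" and "(q::real) > 0"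
    and steep: "\<And>x d. x \<in> E \<Longrightarrow> 0 < d \<Longrightarrow> \<exists>s t. s < x \<and> x < t \<and> t - s < d \<and> q * (t - s) < h t - h s"
  shows "emeasure lborel E \<le> ennreal (1 / q) * emeasure (image_measure h) E"
proof -
  have "emeasure lborel E \<le> ennreal (1 / q) * emeasure (image_measure h) E + ennreal e" if "e > 0" for e :: real
  proof -
    \<comment> \<open>The excess allowed for \<open>U\<close> will be divided by \<open>q\<close>,
      which leaves \<open>e\<close>.\<close>
    have "q * e > 0" using \<open>q > 0\<close> \<open>e > 0\<close> by simp
    then obtain U where U: "open U" "E \<subseteq> U"
      "emeasure (image_measure h) U \<le> emeasure (image_measure h) E + ennreal (q * e)"
      by (rule image_measure_outer_open[OF h E])
    obtain \<D> where \<D>: "countable \<D>" "disjoint \<D>" "\<Union>\<D> \<subseteq> U"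
      "\<forall>D\<in>\<D>. \<exists>s t. s < t \<and> D = {s..t} \<and> q * (t - s) < h t - h s"
      "E - \<Union>\<D> \<in> null_sets lborel"
      by (rule vitali_intervals[OF E U(1,2), where P="\<lambda>s t. q * (t - s) < h t - h s"], erule (1) steep, rule that)
    have Db: "D \<in> sets borel" if "D \<in> \<D>" for D using bspec[OF \<D>(4) that] by (elim exE conjE) simp
    have W: "\<Union>\<D> \<in> sets borel" using \<D>(1) Db by (intro sets.countable_Union) auto
    have "emeasure lborel (\<Union>\<D>) \<le> ennreal (1 / q) * emeasure (image_measure h) U"
    proof (rule emeasure_le_by_disjoint_cover[OF _ \<D>(1,2)])
      fix D assume D: "D \<in> \<D>"
      with \<D>(4) obtain s t where st: "s < t" "D = {s..t}" "q * (t - s) < h t - h s" by blast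
      have eq: "\<Union>\<D> \<inter> D = D" "U \<inter> D = D" using D \<D>(3) by auto
      have "t - s \<le> (1 / q) * (h t - h s)" using st(3) \<open>q > 0\<close> by (simp add: field_simps)
      then have "ennreal (t - s) \<le> ennreal ((1 / q) * (h t - h s))" by (rule ennreal_leI)
      also have "\<dots> = ennreal (1 / q) * ennreal (h t - h s)"
        using \<open>q > 0\<close> st(1) increasing_homeo_less_iff[OF h] by (intro ennreal_mult) (auto simp: less_imp_le)
      finally show "emeasure lborel (\<Union>\<D> \<inter> D) \<le> ennreal (1 / q) * emeasure (image_measure h) (U \<inter> D)"
        unfolding eq using st(1,2) by (simp add: image_measure_Icc[OF h])
    qed (simp_all add: W U Db)
    also have "\<dots> \<le> ennreal (1 / q) * (emeasure (image_measure h) E + ennreal (q * e))"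
      using U(3) by (intro mult_left_mono) auto
    also have "\<dots> = ennreal (1 / q) * emeasure (image_measure h) E + ennreal (1 / q) * ennreal (q * e)"
      by (rule distrib_left)
    also have "ennreal (1 / q) * ennreal (q * e) = ennreal e"
      using \<open>q > 0\<close> \<open>e > 0\<close> by (subst ennreal_mult[symmetric]) auto
    finally have *: "emeasure lborel (\<Union>\<D>) \<le> ennreal (1 / q) * emeasure (image_measure h) E + ennreal e" .
    have "emeasure lborel E \<le> emeasure lborel (\<Union>\<D> \<union> (E - \<Union>\<D>))"
      using E W by (intro emeasure_mono) auto
    also have "\<dots> = emeasure lborel (\<Union>\<D>)"
      using \<D>(5) W by (intro emeasure_Un_null_set) auto
    finally show ?thesis using * by simp
  qed
  then show ?thesis by (rule ennreal_le_epsilon)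
qed

text \<open>The covering argument again, with the two measures exchanged. Vitali's leftover is null
  for Lebesgue measure but has to be null for the image measure; this is where absolute continuity
  enters, through Lusin's property (N).\<close>

lemma image_measure_le_measure_of_small_slopes:
  assumes h: "increasing_homeo h" and ac: "locally_abs_continuous h"
    and E: "E \<in> sets borel" and "(p::real) > 0"
    and flat: "\<And>x d. x \<in> E \<Longrightarrow> 0 < d \<Longrightarrow> \<exists>s t. s < x \<and> x < t \<and> t - s < d \<and> h t - h s < p * (t - s)"
  shows "emeasure (image_measure h) E \<le> ennreal p * emeasure lborel E"
proof -
  have "emeasure (image_measure h) E \<le> ennreal p * emeasure lborel E + ennreal e" if "e > 0" for e :: real
  proof -
    have "e / p > 0" using \<open>p > 0\<close> \<open>e > 0\<close> by simp
    then obtain U where U: "open U" "E \<subseteq> U" "emeasure lborel (U - E) < ennreal (e / p)"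
      by (rule outer_regular_lborel[OF E])
    obtain \<D> where \<D>: "countable \<D>" "disjoint \<D>" "\<Union>\<D> \<subseteq> U"
      "\<forall>D\<in>\<D>. \<exists>s t. s < t \<and> D = {s..t} \<and> h t - h s < p * (t - s)"
      "E - \<Union>\<D> \<in> null_sets lborel"
      by (rule vitali_intervals[OF E U(1,2), where P="\<lambda>s t. h t - h s < p * (t - s)"], erule (1) flat, rule that)
    have Db: "D \<in> sets borel" if "D \<in> \<D>" for D using bspec[OF \<D>(4) that] by (elim exE conjE) simp
    have W: "\<Union>\<D> \<in> sets borel" using \<D>(1) Db by (intro sets.countable_Union) auto
    have "emeasure lborel U = emeasure lborel (E \<union> (U - E))"
      using U(2) by (intro arg_cong[where f="emeasure lborel"]) auto
    also have "\<dots> \<le> emeasure lborel E + emeasure lborel (U - E)"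
      using U E by (intro emeasure_subadditive) auto
    also have "\<dots> \<le> emeasure lborel E + ennreal (e / p)"
      using U(3) by (intro add_left_mono) simp
    finally have Ue: "emeasure lborel U \<le> emeasure lborel E + ennreal (e / p)" .
    have "emeasure (image_measure h) (\<Union>\<D>) \<le> ennreal p * emeasure lborel U"
    proof (rule emeasure_le_by_disjoint_cover[OF _ \<D>(1,2)])
      fix D assume D: "D \<in> \<D>"
      with \<D>(4) obtain s t where st: "s < t" "D = {s..t}" "h t - h s < p * (t - s)" by blast
      have eq: "\<Union>\<D> \<inter> D = D" "U \<inter> D = D" using D \<D>(3) by auto
      have "ennreal (h t - h s) \<le> ennreal (p * (t - s))" using st(3) by (intro ennreal_leI) simp
      also have "\<dots> = ennreal p * ennreal (t - s)"
        using \<open>p > 0\<close> st(1) by (intro ennreal_mult) auto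
      finally show "emeasure (image_measure h) (\<Union>\<D> \<inter> D) \<le> ennreal p * emeasure lborel (U \<inter> D)"
        unfolding eq using st(1,2) by (simp add: image_measure_Icc[OF h])
    qed (simp_all add: W U Db)
    also have "\<dots> \<le> ennreal p * (emeasure lborel E + ennreal (e / p))"
      using Ue by (intro mult_left_mono) auto
    also have "\<dots> = ennreal p * emeasure lborel E + ennreal p * ennreal (e / p)"
      by (rule distrib_left)
    also have "ennreal p * ennreal (e / p) = ennreal e"
      using \<open>p > 0\<close> \<open>e > 0\<close> by (subst ennreal_mult[symmetric]) auto
    finally have *: "emeasure (image_measure h) (\<Union>\<D>) \<le> ennreal p * emeasure lborel E + ennreal e" .
    have "h ` (E - \<Union>\<D>) \<in> null_sets lborel"
      using abs_continuous_image_null[OF h ac \<D>(5)] .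
    then have null: "E - \<Union>\<D> \<in> null_sets (image_measure h)"
      using E W by (simp add: null_sets_def emeasure_image_measure[OF h])
    have "emeasure (image_measure h) E \<le> emeasure (image_measure h) (\<Union>\<D> \<union> (E - \<Union>\<D>))"
      using E W by (intro emeasure_mono) auto
    also have "\<dots> = emeasure (image_measure h) (\<Union>\<D>)"
      using null W by (intro emeasure_Un_null_set) auto
    finally show ?thesis using * by simp
  qed
  then show ?thesis by (rule ennreal_le_epsilon)
qed

text \<open>The hypothesis controls intervals with \<open>x\<close> strictly inside. Letting one end
  point tend to \<open>x\<close>, continuity of \<open>h\<close> turns it into a bound on one-sided
  difference quotients.\<close>

lemma has_derivative_from_slopes:
  fixes h :: "real \<Rightarrow> real"
  assumes cont: "continuous_on UNIV h"
    and slopes: "\<And>e. 0 < e \<Longrightarrow> \<exists>d>0. \<forall>s t. s < x \<and> x < t \<and> t - s < d \<longrightarrow>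
      \<bar>h t - h s - w * (t - s)\<bar> \<le> e * (t - s)"
  shows "(h has_real_derivative w) (at x)"
proof -
  have "\<exists>d>0. \<forall>y. norm (y - x) < d \<longrightarrow> norm (h y - h x - w * (y - x)) \<le> e * norm (y - x)" if e: "e > 0" for e
  proof -
    obtain d where d: "d > 0"
      "\<And>s t. s < x \<Longrightarrow> x < t \<Longrightarrow> t - s < d \<Longrightarrow> \<bar>h t - h s - w * (t - s)\<bar> \<le> e * (t - s)"
      using slopes[OF e] by blast
    have hc: "(h \<longlongrightarrow> h x) (at x within A)" for A
    proof -
      have "(h \<longlongrightarrow> h x) (at x)" using cont unfolding continuous_on_def by blast
      then show ?thesis by (rule tendsto_within_subset) simp
    qed
    have "norm (h y - h x - w * (y - x)) \<le> e * norm (y - x)" if y: "norm (y - x) < d" for y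
    proof (cases "y = x")
      case False
      then consider "x < y" | "y < x" by linarith
      then show ?thesis
      proof cases
        case 1
        have lim: "((\<lambda>s. e * (y - s) - \<bar>h y - h s - w * (y - s)\<bar>) \<longlongrightarrow> e * (y - x) - \<bar>h y - h x - w * (y - x)\<bar>) (at_left x)"
          by (intro tendsto_intros hc)
        have "eventually (\<lambda>s. 0 \<le> e * (y - s) - \<bar>h y - h s - w * (y - s)\<bar>) (at_left x)"
          unfolding eventually_at_left_field
          by (rule exI[of _ "y - d"]) (use 1 y d(2)[OF _ 1] in auto)
        from tendsto_lowerbound[OF lim this] show ?thesis using 1 by simp
      next
        case 2
        have lim: "((\<lambda>t. e * (t - y) - \<bar>h t - h y - w * (t - y)\<bar>) \<longlongrightarrow> e * (x - y) - \<bar>h x - h y - w * (x - y)\<bar>) (at_right x)"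
          by (intro tendsto_intros hc)
        have "eventually (\<lambda>t. 0 \<le> e * (t - y) - \<bar>h t - h y - w * (t - y)\<bar>) (at_right x)"
          unfolding eventually_at_right_field
          by (rule exI[of _ "y + d"]) (use 2 y d(2)[OF 2] in auto)
        from tendsto_lowerbound[OF lim this]
        have "\<bar>h x - h y - w * (x - y)\<bar> \<le> e * (x - y)" by simp
        moreover have "h x - h y - w * (x - y) = - (h y - h x - w * (y - x))" by (simp add: algebra_simps)
        ultimately show ?thesis using 2 by (simp only: abs_minus_cancel real_norm_def) simp
      qed
    qed simp
    then show ?thesis using d(1) by blast
  qed
  then show ?thesis
    unfolding has_field_derivative_def has_derivative_within_alt
    by (simp add: bounded_linear_mult_right)
qed

text \<open>Such sets stand in for the level sets of the upper and lower derivates. Because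
  \<open>x\<close> is strictly inside the intervals and the lengths run through a sequence, they are
  countable intersections of open sets, hence Borel for every \<open>P\<close>.\<close>

definition short_interval_points :: "(real \<Rightarrow> real \<Rightarrow> bool) \<Rightarrow> real set" where
  "short_interval_points P = {x. \<forall>n. \<exists>s t. s < x \<and> x < t \<and> t - s < inverse (real (Suc n)) \<and> P s t}"

lemma short_interval_points_borel: "short_interval_points P \<in> sets borel"
proof -
  have "short_interval_points P = (\<Inter>n. \<Union>{{s<..<t} | s t. t - s < inverse (real (Suc n)) \<and> P s t})"
    unfolding short_interval_points_def by (simp add: set_eq_iff) (metis greaterThanLessThan_iff)
  moreover have "open (\<Union>{{s<..<t} | s t. t - s < inverse (real (Suc n)) \<and> P s t})" for n
    by (intro open_Union) auto
  ultimately show ?thesis by auto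
qed

lemma short_interval_pointsD:
  assumes "x \<in> short_interval_points P" "0 < d"
  shows "\<exists>s t. s < x \<and> x < t \<and> t - s < d \<and> P s t"
proof -
  obtain n where "inverse (real (Suc n)) < d" using reals_Archimedean[OF assms(2)] by blast
  moreover obtain s t where "s < x" "x < t" "t - s < inverse (real (Suc n))" "P s t"
    using assms(1) unfolding short_interval_points_def by blast
  ultimately show ?thesis by (intro exI[of _ s] exI[of _ t]) auto
qed

lemma not_short_interval_pointsD:
  assumes "x \<notin> short_interval_points P"
  obtains d where "d > 0" "\<And>s t. s < x \<Longrightarrow> x < t \<Longrightarrow> t - s < d \<Longrightarrow> \<not> P s t"
proof -
  obtain n where "\<not> (\<exists>s t. s < x \<and> x < t \<and> t - s < inverse (real (Suc n)) \<and> P s t)"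
    using assms unfolding short_interval_points_def by blast
  then show thesis using that[of "inverse (real (Suc n))"] by auto
qed

lemma null_if_le_fraction_of_itself:
  assumes "emeasure M E \<le> ennreal a * (ennreal b * emeasure M E)" "emeasure M E < \<infinity>"
    and "0 \<le> a" "0 \<le> b" "a * b < 1"
  shows "emeasure M E = 0"
proof -
  have eq: "emeasure M E = ennreal (measure M E)"
    using assms(2) by (simp add: emeasure_eq_ennreal_measure)
  have "ennreal (measure M E) \<le> ennreal (a * (b * measure M E))"
    using assms(1,3,4) unfolding eq by (simp add: ennreal_mult)
  then have "measure M E \<le> a * b * measure M E"
    using assms(3,4) by (simp add: ennreal_le_iff mult.assoc)
  then have "(1 - a * b) * measure M E \<le> 0" by (simp add: algebra_simps)
  then have "measure M E \<le> 0" using assms(5) by (simp add: mult_le_0_iff)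
  then show ?thesis unfolding eq by (simp add: measure_le_0_iff)
qed

lemma AE_lborel_bounded:
  assumes "\<And>n::nat. AE x in lborel. x \<in> {- real n..real n} \<longrightarrow> P (x::real)"
  shows "AE x in lborel. P x"
proof -
  have "AE x in lborel. \<forall>n::nat. x \<in> {- real n..real n} \<longrightarrow> P x"
    by (subst AE_all_countable) (rule allI, rule assms)
  then show ?thesis
  proof (rule AE_mp, intro AE_I2 impI)
    fix x :: real assume *: "\<forall>n::nat. x \<in> {- real n..real n} \<longrightarrow> P x"
    obtain n :: nat where "\<bar>x\<bar> < real n" using reals_Archimedean2 by blast
    then have "x \<in> {- real n..real n}" by auto
    then show "P x" using * by blast
  qed
qed

text \<open>Let \<open>f\<close> be the Radon-Nikodym density. On a bounded set \<open>E\<close>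
  where \<open>f < p < q\<close> while intervals of slope above \<open>q\<close> shrink to each
  point, one gets \<open>q |E| \<le> |h(E)| \<le> p |E|\<close>, so \<open>E\<close> is null;
  likewise for slopes below \<open>p\<close> where \<open>f > q\<close>. Rational pairs
  \<open>p < q\<close> then squeeze the slopes at almost every point towards
  \<open>f\<close>.\<close>

lemma image_measure_density:
  assumes h: "increasing_homeo h" and ac: "locally_abs_continuous h"
  obtains w where "w \<in> borel_measurable borel" "\<And>x. 0 \<le> w x"
    "AE x in lborel. (h has_real_derivative w x) (at x)"
    "\<And>A. A \<in> sets borel \<Longrightarrow> emeasure lborel (h ` A) = (\<integral>\<^sup>+x. ennreal (w x) * indicator A x \<partial>lborel)"
proof -
  have "null_sets lborel \<subseteq> null_sets (image_measure h)"
  proof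
    fix N assume N: "N \<in> null_sets (lborel :: real measure)"
    then have "h ` N \<in> null_sets lborel" by (rule abs_continuous_image_null[OF h ac])
    then show "N \<in> null_sets (image_measure h)"
      using N by (simp add: null_sets_def emeasure_image_measure[OF h])
  qed
  then have abscont: "absolutely_continuous lborel (image_measure h)"
    unfolding absolutely_continuous_def .
  obtain f where fm: "f \<in> borel_measurable lborel" and fd: "density lborel f = image_measure h"
    using sigma_finite_measure.Radon_Nikodym[OF sigma_finite_lborel abscont] by auto
  have fb[measurable]: "f \<in> borel_measurable borel" using fm by simp
  have em: "emeasure (image_measure h) A = (\<integral>\<^sup>+x. f x * indicator A x \<partial>lborel)" if "A \<in> sets borel" for A
    unfolding fd[symmetric] using that by (intro emeasure_density) auto
  \<comment> \<open>\<open>enn2real\<close> sends infinity to 0. This changes \<open>f\<close> on a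
    null set only, since bounded intervals have finite image measure.\<close>
  define w where "w x = enn2real (f x)" for x
  have "AE x in lborel. x \<in> {- real n..real n} \<longrightarrow> f x \<noteq> \<infinity>" for n :: nat
  proof -
    have "(\<integral>\<^sup>+x. f x * indicator {- real n..real n} x \<partial>lborel) \<noteq> \<infinity>"
      using image_measure_Icc[OF h, of "- real n" "real n"] em[of "{- real n..real n}"] by simp
    then have "AE x in lborel. f x * indicator {- real n..real n} x \<noteq> \<infinity>"
      by (intro nn_integral_PInf_AE) auto
    then show ?thesis by (rule AE_mp) (auto intro!: AE_I2 split: split_indicator)
  qed
  then have finite: "AE x in lborel. f x \<noteq> \<infinity>" by (rule AE_lborel_bounded)
  then have fw: "AE x in lborel. f x = ennreal (w x)"
    by (rule AE_mp) (auto intro!: AE_I2 simp: w_def less_top)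
  let ?up = "\<lambda>q. short_interval_points (\<lambda>s t. q * (t - s) < h t - h s)"
  let ?lo = "\<lambda>p. short_interval_points (\<lambda>s t. h t - h s < p * (t - s))"
  have up: "AE x in lborel. x \<in> ?up q \<longrightarrow> \<not> f x < ennreal p" if pq: "0 < p" "p < q" for p q
  proof (rule AE_lborel_bounded)
    fix n :: nat
    let ?E = "?up q \<inter> {x. f x < ennreal p} \<inter> {- real n..real n}"
    have fE: "{x. f x < ennreal p} \<in> sets borel" by measurable
    have E: "?E \<in> sets borel" by (intro sets.Int short_interval_points_borel fE) simp
    have "emeasure lborel ?E \<le> ennreal (1 / q) * emeasure (image_measure h) ?E"
      by (rule measure_le_image_measure_of_large_slopes[OF h E]) (use pq short_interval_pointsD in auto)
    also have "emeasure (image_measure h) ?E \<le> (\<integral>\<^sup>+x. ennreal p * indicator ?E x \<partial>lborel)"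
      unfolding em[OF E] by (intro nn_integral_mono) (auto split: split_indicator)
    also have "(\<integral>\<^sup>+x. ennreal p * indicator ?E x \<partial>lborel) = ennreal p * emeasure lborel ?E"
      using E by (intro nn_integral_cmult_indicator) simp
    finally have le: "emeasure lborel ?E \<le> ennreal (1 / q) * (ennreal p * emeasure lborel ?E)"
      by (simp add: mult_left_mono)
    have "?E \<in> fmeasurable lborel"
      by (rule fmeasurable_lborel_bounded[OF E]) auto
    then have "emeasure lborel ?E < \<infinity>" by (simp add: fmeasurable_def)
    with le have "emeasure lborel ?E = 0"
      by (rule null_if_le_fraction_of_itself) (use pq in auto)
    then have "?E \<in> null_sets lborel" using E by (simp add: null_sets_def)
    then have "AE x in lborel. x \<notin> ?E" by (rule AE_not_in)
    then show "AE x in lborel. x \<in> {- real n..real n} \<longrightarrow> x \<in> ?up q \<longrightarrow> \<not> f x < ennreal p"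
      by (rule AE_mp) (auto intro!: AE_I2)
  qed
  have lo: "AE x in lborel. x \<in> ?lo p \<longrightarrow> \<not> ennreal q < f x" if pq: "0 < p" "p < q" for p q
  proof (rule AE_lborel_bounded)
    fix n :: nat
    let ?E = "?lo p \<inter> {x. ennreal q < f x} \<inter> {- real n..real n}"
    have fE: "{x. ennreal q < f x} \<in> sets borel" by measurable
    have E: "?E \<in> sets borel" by (intro sets.Int short_interval_points_borel fE) simp
    have "ennreal q * emeasure lborel ?E = (\<integral>\<^sup>+x. ennreal q * indicator ?E x \<partial>lborel)"
      using E by (intro nn_integral_cmult_indicator[symmetric]) simp
    also have "\<dots> \<le> emeasure (image_measure h) ?E"
      unfolding em[OF E] by (intro nn_integral_mono) (auto split: split_indicator)
    also have "\<dots> \<le> ennreal p * emeasure lborel ?E"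
      by (rule image_measure_le_measure_of_small_slopes[OF h ac E]) (use pq short_interval_pointsD in auto)
    finally have *: "ennreal q * emeasure lborel ?E \<le> ennreal p * emeasure lborel ?E" .
    have "emeasure lborel ?E = ennreal (1 / q) * (ennreal q * emeasure lborel ?E)"
    proof -
      have "ennreal (1 / q) * ennreal q = 1" using pq by (subst ennreal_mult[symmetric]) auto
      then show ?thesis by (simp add: mult.assoc[symmetric])
    qed
    also have "\<dots> \<le> ennreal (1 / q) * (ennreal p * emeasure lborel ?E)"
      using * by (rule mult_left_mono) simp
    finally have le: "emeasure lborel ?E \<le> ennreal (1 / q) * (ennreal p * emeasure lborel ?E)" .
    have "?E \<in> fmeasurable lborel"
      by (rule fmeasurable_lborel_bounded[OF E]) auto
    then have "emeasure lborel ?E < \<infinity>" by (simp add: fmeasurable_def)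
    with le have "emeasure lborel ?E = 0"
      by (rule null_if_le_fraction_of_itself) (use pq in auto)
    then have "?E \<in> null_sets lborel" using E by (simp add: null_sets_def)
    then have "AE x in lborel. x \<notin> ?E" by (rule AE_not_in)
    then show "AE x in lborel. x \<in> {- real n..real n} \<longrightarrow> x \<in> ?lo p \<longrightarrow> \<not> ennreal q < f x"
      by (rule AE_mp) (auto intro!: AE_I2)
  qed
  have "AE x in lborel. \<forall>p\<in>\<rat>. \<forall>q\<in>\<rat>. 0 < p \<longrightarrow> p < q \<longrightarrow>
      (x \<in> ?up q \<longrightarrow> \<not> f x < ennreal p) \<and> (x \<in> ?lo p \<longrightarrow> \<not> ennreal q < f x)"
    using up lo by (simp add: AE_ball_countable[OF countable_rat])
  with fw have deriv: "AE x in lborel. (h has_real_derivative w x) (at x)"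
  proof eventually_elim
    fix x assume fx: "f x = ennreal (w x)"
      and x: "\<forall>p\<in>\<rat>. \<forall>q\<in>\<rat>. 0 < p \<longrightarrow> p < q \<longrightarrow>
      (x \<in> ?up q \<longrightarrow> \<not> f x < ennreal p) \<and> (x \<in> ?lo p \<longrightarrow> \<not> ennreal q < f x)"
    have w0: "0 \<le> w x" unfolding w_def by simp
    show "(h has_real_derivative w x) (at x)"
    proof (rule has_derivative_from_slopes)
      show "continuous_on UNIV h" using increasing_homeoD[OF h] by simp
      fix e :: real assume "0 < e"
      obtain p q where pq: "p \<in> \<rat>" "q \<in> \<rat>" "w x < p" "p < q" "q < w x + e"
        using Rats_dense_in_real[of "w x" "w x + e"] Rats_dense_in_real \<open>0 < e\<close> by (metis less_add_same_cancel1)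
      have "f x < ennreal p" unfolding fx using pq w0 by (simp add: ennreal_less_iff)
      then have "x \<notin> ?up q" using x pq w0 by force
      then obtain d1 where d1: "d1 > 0"
        "\<And>s t. s < x \<Longrightarrow> x < t \<Longrightarrow> t - s < d1 \<Longrightarrow> \<not> q * (t - s) < h t - h s"
        by (rule not_short_interval_pointsD) blast
      have up': "h t - h s - w x * (t - s) \<le> e * (t - s)" if "s < x" "x < t" "t - s < d1" for s t
      proof -
        have "h t - h s \<le> q * (t - s)" using d1(2)[OF that] by simp
        also have "\<dots> \<le> (w x + e) * (t - s)" using pq that by (intro mult_right_mono) auto
        finally show ?thesis by (simp add: algebra_simps)
      qed
      obtain d2 where d2: "d2 > 0"
        "\<And>s t. s < x \<Longrightarrow> x < t \<Longrightarrow> t - s < d2 \<Longrightarrow> - e * (t - s) \<le> h t - h s - w x * (t - s)"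
      \<comment> \<open>The lower comparison uses positive rationals below \<open>w x\<close>. There
        are none if \<open>w x = 0\<close>, and then monotonicity of \<open>h\<close> gives the
        bound.\<close>
      proof (cases "w x = 0")
        case True
        have "- e * (t - s) \<le> h t - h s - w x * (t - s)" if "s < x" "x < t" for s t
        proof -
          have "- e * (t - s) \<le> 0" using that \<open>0 < e\<close> by (simp add: mult_nonneg_nonneg)
          moreover have "h s \<le> h t" using that increasing_homeo_less_iff[OF h] by simp
          ultimately show ?thesis using True by simp
        qed
        then show ?thesis by (intro that[of 1]) auto
      next
        case False
        define l where "l = max 0 (w x - e)"
        have l: "l < w x" "0 \<le> l" "w x - e \<le> l" using False w0 \<open>0 < e\<close> unfolding l_def by auto
        obtain p q where pq: "p \<in> \<rat>" "q \<in> \<rat>" "l < p" "p < q" "q < w x"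
          using Rats_dense_in_real l(1) by metis
        have "ennreal q < f x" unfolding fx using pq l w0 by (simp add: ennreal_less_iff)
        then have "x \<notin> ?lo p" using x pq l by force
        then obtain d where d: "d > 0"
          "\<And>s t. s < x \<Longrightarrow> x < t \<Longrightarrow> t - s < d \<Longrightarrow> \<not> h t - h s < p * (t - s)"
          by (rule not_short_interval_pointsD) blast
        have "- e * (t - s) \<le> h t - h s - w x * (t - s)" if "s < x" "x < t" "t - s < d" for s t
        proof -
          have "(w x - e) * (t - s) \<le> p * (t - s)" using pq l that by (intro mult_right_mono) auto
          also have "\<dots> \<le> h t - h s" using d(2)[OF that] by simp
          finally show ?thesis by (simp add: algebra_simps)
        qed
        then show ?thesis using that d(1) by blast
      qed
      have "\<bar>h t - h s - w x * (t - s)\<bar> \<le> e * (t - s)" if "s < x" "x < t" "t - s < min d1 d2" for s t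
        using up'[of s t] d2(2)[of s t] that by (intro abs_leI) auto
      then show "\<exists>d>0. \<forall>s t. s < x \<and> x < t \<and> t - s < d \<longrightarrow> \<bar>h t - h s - w x * (t - s)\<bar> \<le> e * (t - s)"
        using d1(1) d2(1) by (intro exI[of _ "min d1 d2"]) auto
    qed
  qed
  have "emeasure lborel (h ` A) = (\<integral>\<^sup>+x. ennreal (w x) * indicator A x \<partial>lborel)" if "A \<in> sets borel" for A
  proof -
    have "emeasure lborel (h ` A) = (\<integral>\<^sup>+x. f x * indicator A x \<partial>lborel)"
      using em[OF that] emeasure_image_measure[OF h that] by simp
    also have "\<dots> = (\<integral>\<^sup>+x. ennreal (w x) * indicator A x \<partial>lborel)"
      using fw by (intro nn_integral_cong_AE) auto
    finally show ?thesis .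
  qed
  moreover have "w \<in> borel_measurable borel" unfolding w_def by measurable
  ultimately show thesis using that[of w] deriv by (simp add: w_def)
qed

section \<open>Power laws and strong quasisymmetry\<close>

lemma borel_measurable_lebesgue_cong_AE:
  fixes f g :: "real \<Rightarrow> real"
  assumes f: "f \<in> borel_measurable lebesgue" and ae: "AE x in lebesgue. f x = g x"
  shows "g \<in> borel_measurable lebesgue"
proof (rule measurableI)
  fix A :: "real set" assume "A \<in> sets borel"
  then have "f -` A \<in> sets lebesgue" using measurable_sets[OF f, of A] by simp
  have "AE x in lebesgue. x \<in> f -` A \<longleftrightarrow> x \<in> g -` A"
    using ae by (rule AE_mp) (auto intro!: AE_I2)
  then have "g -` A \<in> sets lebesgue"
    using \<open>f -` A \<in> sets lebesgue\<close> by (rule completion.in_sets_AE) simp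
  then show "g -` A \<inter> space lebesgue \<in> sets lebesgue" by simp
qed simp

lemma set_integral_cong_AE_lebesgue:
  fixes f g :: "real \<Rightarrow> real"
  assumes f: "set_integrable lebesgue A f" and ae: "AE x in lebesgue. indicator A x *\<^sub>R f x = indicator B x *\<^sub>R g x"
  shows "set_integrable lebesgue B g" "(LINT x:A|lebesgue. f x) = (LINT x:B|lebesgue. g x)"
proof -
  have fm: "(\<lambda>x. indicator A x *\<^sub>R f x) \<in> borel_measurable lebesgue"
    using f unfolding set_integrable_def by (rule borel_measurable_integrable)
  have gm: "(\<lambda>x. indicator B x *\<^sub>R g x) \<in> borel_measurable lebesgue"
    using borel_measurable_lebesgue_cong_AE[OF fm ae] .
  show "set_integrable lebesgue B g"
    using f unfolding set_integrable_def integrable_cong_AE[OF fm gm ae] .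
  show "(LINT x:A|lebesgue. f x) = (LINT x:B|lebesgue. g x)"
    unfolding set_lebesgue_integral_def by (rule integral_cong_AE[OF fm gm ae])
qed

lemma ae_deriv_eq: "(h has_real_derivative w) (at x) \<Longrightarrow> ae_deriv h x = w"
  unfolding ae_deriv_def by (auto simp: DERIV_imp_deriv real_differentiable_def)

lemma ae_deriv_nonneg:
  assumes "increasing_homeo h"
  shows "0 \<le> ae_deriv h x"
proof (cases "h differentiable (at x)")
  case True
  then have d: "(h has_real_derivative deriv h x) (at x)" by (simp add: DERIV_deriv_iff_real_differentiable)
  have "0 \<le> deriv h x"
    by (rule mono_on_imp_deriv_nonneg[of UNIV, OF _ d])
       (use increasing_homeo_less_iff[OF assms] in \<open>auto simp: mono_on_def\<close>)
  then show ?thesis by (simp add: ae_deriv_def)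
qed (simp add: ae_deriv_def)

text \<open>\<open>ae_deriv h\<close> agrees almost everywhere with a Borel density of the image
  measure, so it inherits measurability and integrals from that density. Over bounded Borel sets
  this is the fundamental theorem of calculus in terms of image lengths.\<close>

lemma ae_deriv_properties:
  assumes h: "increasing_homeo h" and ac: "locally_abs_continuous h"
  shows ae_deriv_measurable: "ae_deriv h \<in> borel_measurable lebesgue"
    and ae_has_deriv: "AE x in lborel. (h has_real_derivative ae_deriv h x) (at x)"
    and ae_deriv_integrable: "\<And>E a b. E \<in> sets lebesgue \<Longrightarrow> E \<subseteq> {a..b} \<Longrightarrow> set_integrable lebesgue E (ae_deriv h)"
    and ae_deriv_integral: "\<And>E a b. E \<in> sets borel \<Longrightarrow> E \<subseteq> {a..b} \<Longrightarrow>
      (LINT x:E|lebesgue. ae_deriv h x) = measure lborel (h ` E)"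
proof -
  obtain w where w[measurable]: "w \<in> borel_measurable borel" and w0: "\<And>x. 0 \<le> w x"
    and dw: "AE x in lborel. (h has_real_derivative w x) (at x)"
    and em: "\<And>A. A \<in> sets borel \<Longrightarrow> emeasure lborel (h ` A) = (\<integral>\<^sup>+x. ennreal (w x) * indicator A x \<partial>lborel)"
    by (rule image_measure_density[OF h ac]) blast
  have eq: "AE x in lborel. w x = ae_deriv h x"
    using dw by (rule AE_mp) (auto intro!: AE_I2 simp: ae_deriv_eq)
  then have eqL: "AE x in lebesgue. w x = ae_deriv h x" by (rule AE_completion)
  show "AE x in lborel. (h has_real_derivative ae_deriv h x) (at x)"
    using dw by (rule AE_mp) (auto intro!: AE_I2 simp: ae_deriv_eq)
  have wL: "w \<in> borel_measurable lebesgue" using w by (simp add: measurable_completion)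
  show m: "ae_deriv h \<in> borel_measurable lebesgue"
    by (rule borel_measurable_lebesgue_cong_AE[OF wL eqL])
  have int: "has_bochner_integral lborel (\<lambda>x. indicator E x *\<^sub>R w x) (measure lborel (h ` E))"
    if E: "E \<in> sets borel" "E \<subseteq> {a..b}" for E a b
  proof (rule has_bochner_integral_nn_integral)
    have "h ` E \<in> fmeasurable lborel"
      by (rule fmeasurable_lborel_bounded[of _ "h a" "h b"])
         (use E borel_image[OF h] increasing_homeo_less_iff[OF h] in auto)
    then have "emeasure lborel (h ` E) = ennreal (measure lborel (h ` E))"
      by (rule emeasure_eq_measure2)
    moreover have "(\<integral>\<^sup>+x. ennreal (indicator E x *\<^sub>R w x) \<partial>lborel) = (\<integral>\<^sup>+x. ennreal (w x) * indicator E x \<partial>lborel)"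
      by (intro nn_integral_cong) (auto split: split_indicator)
    ultimately show "(\<integral>\<^sup>+x. ennreal (indicator E x *\<^sub>R w x) \<partial>lborel) = ennreal (measure lborel (h ` E))"
      using em[OF E(1)] by simp
  qed (use E w0 in auto)
  have intL: "set_integrable lebesgue E w" "(LINT x:E|lebesgue. w x) = measure lborel (h ` E)"
    if E: "E \<in> sets borel" "E \<subseteq> {a..b}" for E a b
  proof -
    have hb: "has_bochner_integral lebesgue (\<lambda>x. indicator E x *\<^sub>R w x) (measure lborel (h ` E))"
      using int[OF E] E(1) by (simp add: has_bochner_integral_iff integrable_completion integral_completion)
    then show "set_integrable lebesgue E w" "(LINT x:E|lebesgue. w x) = measure lborel (h ` E)"
      by (auto simp: has_bochner_integral_iff set_integrable_def set_lebesgue_integral_def)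
  qed
  have ae: "AE x in lebesgue. indicator E x *\<^sub>R w x = indicator E x *\<^sub>R ae_deriv h x" for E
    using eqL by (rule AE_mp) (auto intro!: AE_I2)
  show "(LINT x:E|lebesgue. ae_deriv h x) = measure lborel (h ` E)"
    if E: "E \<in> sets borel" "E \<subseteq> {a..b}" for E a b
    using set_integral_cong_AE_lebesgue(2)[OF intL(1)[OF E] ae] intL(2)[OF E] by simp
  show "set_integrable lebesgue E (ae_deriv h)"
    if E: "E \<in> sets lebesgue" "E \<subseteq> {a..b}" for E a b
  proof -
    have "set_integrable lebesgue {a..b} (ae_deriv h)"
      using set_integral_cong_AE_lebesgue(1)[OF intL(1)[of "{a..b}" a b] ae] by simp
    then show ?thesis using E by (rule set_integrable_subset)
  qed
qed

text \<open>\<open>A_infinity_weight\<close> tests Lebesgue sets, whereas the power law tests Borel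
  sets, whose images under a homeomorphism are Borel again. A Borel subset of full measure links the
  two.\<close>

lemma lebesgue_set_borel_part:
  fixes E :: "real set"
  assumes "E \<in> sets lebesgue"
  obtains F where "F \<in> sets borel" "F \<subseteq> E" "AE x in lebesgue. x \<in> F \<longleftrightarrow> x \<in> E"
proof -
  have Eu: "E = main_part lborel E \<union> null_part lborel E"
    using main_part_null_part_Un[OF assms] by simp
  obtain N where N: "N \<in> null_sets lborel" "null_part lborel E \<subseteq> N" using null_part[OF assms] by auto
  have "AE x in lebesgue. x \<notin> N" by (intro AE_completion AE_not_in N)
  then have "AE x in lebesgue. x \<in> main_part lborel E \<longleftrightarrow> x \<in> E"
    by (rule AE_mp) (use Eu N(2) in \<open>auto intro!: AE_I2\<close>)
  moreover have "main_part lborel E \<in> sets borel" using main_part_sets[OF assms] by simp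
  moreover have "main_part lborel E \<subseteq> E" using Eu by blast
  ultimately show thesis using that by blast
qed

definition A_infinity_homeo :: "(real \<Rightarrow> real) \<Rightarrow> bool" where
  "A_infinity_homeo h \<longleftrightarrow> increasing_homeo h \<and>
     (\<exists>C \<alpha>. 0 < C \<and> 0 < \<alpha> \<and> (\<forall>a b E. a < b \<and> E \<in> sets borel \<and> E \<subseteq> {a..b} \<longrightarrow>
        measure lborel (h ` E) \<le> C * (h b - h a) * (measure lborel E / (b - a)) powr \<alpha>))"

lemma A_infinity_homeoE:
  assumes "A_infinity_homeo h"
  obtains C \<alpha> where "0 < C" "0 < \<alpha>" "\<forall>a b E. a < b \<and> E \<in> sets borel \<and> E \<subseteq> {a..b} \<longrightarrow>
    measure lborel (h ` E) \<le> C * (h b - h a) * (measure lborel E / (b - a)) powr \<alpha>"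
  using assms unfolding A_infinity_homeo_def by (elim exE conjE) (rule that)

lemma measure_image_Icc:
  assumes "increasing_homeo h" "a \<le> b"
  shows "measure lborel (h ` {a..b}) = h b - h a"
  using assms increasing_homeo_less_iff(2)[OF assms(1), of a b] by (simp add: image_Icc_Ioo)

lemma SQS_imp_A_infinity_homeo:
  assumes "h \<in> SQS"
  shows "A_infinity_homeo h"
proof -
  have h: "increasing_homeo h" and ac: "locally_abs_continuous h" and A: "A_infinity_weight (ae_deriv h)"
    using assms by (auto simp: SQS_def)
  obtain C \<alpha> where C: "0 < C" "0 < \<alpha>" and le: "\<forall>a b E. a < b \<and> E \<in> sets lebesgue \<and> E \<subseteq> {a..b} \<longrightarrow>
           (LINT x:E|lebesgue. ae_deriv h x) / (LINT x:{a..b}|lebesgue. ae_deriv h x)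
             \<le> C * (measure lebesgue E / (b - a)) powr \<alpha>"
    using A unfolding A_infinity_weight_def by blast
  have "measure lborel (h ` E) \<le> C * (h b - h a) * (measure lborel E / (b - a)) powr \<alpha>"
    if E: "a < b" "E \<in> sets borel" "E \<subseteq> {a..b}" for a b E
  proof -
    have pos: "h b - h a > 0" using E(1) increasing_homeo_less_iff[OF h] by simp
    have "measure lborel (h ` E) / (h b - h a) \<le> C * (measure lebesgue E / (b - a)) powr \<alpha>"
      using le[rule_format, of a b E] E ae_deriv_integral[OF h ac E(2,3)]
        ae_deriv_integral[OF h ac, of "{a..b}" a b] measure_image_Icc[OF h, of a b]
      by simp
    moreover have "measure lebesgue E = measure lborel E" using E(2) by (simp add: measure_completion)
    ultimately show ?thesis using pos by (simp add: divide_le_eq mult_ac)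
  qed
  then show ?thesis unfolding A_infinity_homeo_def using h C by blast
qed

lemma A_infinity_homeo_abs_continuous:
  assumes "A_infinity_homeo h"
  shows "locally_abs_continuous h"
  unfolding locally_abs_continuous_def
proof (intro allI)
  fix a b
  have h: "increasing_homeo h" using assms by (simp add: A_infinity_homeo_def)
  obtain C \<alpha> where C: "0 < C" "0 < \<alpha>" and le0: "\<forall>a b E. a < b \<and> E \<in> sets borel \<and> E \<subseteq> {a..b} \<longrightarrow>
    measure lborel (h ` E) \<le> C * (h b - h a) * (measure lborel E / (b - a)) powr \<alpha>"
    by (rule A_infinity_homeoE[OF assms])
  note le = le0[rule_format, OF conjI, OF _ conjI]
  show "abs_continuous_on_interval a b h"
  proof (cases "a < b")
    case False
    then have st: "s i = t i" if "a \<le> s i" "s i \<le> t i" "t i \<le> b" for s t :: "nat \<Rightarrow> real" and i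
      using that by linarith
    show ?thesis
      unfolding abs_continuous_on_interval_def
    proof (intro allI impI exI[of _ 1] conjI)
      fix e :: real and n :: nat and s t :: "nat \<Rightarrow> real"
      assume "0 < e" and *: "(\<forall>i<n. a \<le> s i \<and> s i \<le> t i \<and> t i \<le> b) \<and>
        disjoint_family_on (\<lambda>i. {s i<..<t i}) {..<n} \<and> (\<Sum>i<n. t i - s i) < 1"
      have "(\<Sum>i<n. \<bar>h (t i) - h (s i)\<bar>) = 0"
      proof (intro sum.neutral ballI)
        fix i assume "i \<in> {..<n}"
        then have "s i = t i" using * by (intro st) auto
        then show "\<bar>h (t i) - h (s i)\<bar> = 0" by simp
      qed
      then show "(\<Sum>i<n. \<bar>h (t i) - h (s i)\<bar>) < e" using \<open>0 < e\<close> by simp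
    qed simp
  next
    case ab: True
    define K where "K = C * (h b - h a)"
    have K: "K > 0" using C ab increasing_homeo_less_iff[OF h] by (simp add: K_def)
    show ?thesis
      unfolding abs_continuous_on_interval_def
    proof (intro allI impI)
      fix e :: real assume e: "0 < e"
      \<comment> \<open>The solution of \<open>K * (d / (b - a)) powr \<alpha> = e\<close>.\<close>
      define d where "d = (b - a) * (e / K) powr (1 / \<alpha>)"
      have "d > 0" using ab e K by (simp add: d_def)
      moreover have "(\<Sum>i<n. \<bar>h (t i) - h (s i)\<bar>) < e"
        if st: "\<And>i. i < n \<Longrightarrow> a \<le> s i \<and> s i \<le> t i \<and> t i \<le> b"
          and disj: "disjoint_family_on (\<lambda>i. {s i<..<t i}) {..<n}" and small: "(\<Sum>i<n. t i - s i) < d"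
        for n :: nat and s t
      proof -
        define E where "E = (\<Union>i<n. {s i<..<t i})"
        have E: "E \<in> sets borel" "E \<subseteq> {a..b}"
          using st unfolding E_def by (auto intro!: sets.finite_UN) force+
        have mE: "measure lborel E = (\<Sum>i<n. t i - s i)"
          unfolding E_def by (rule measure_disjoint_intervals) (use disj st in auto)
        have "(\<Sum>i<n. \<bar>h (t i) - h (s i)\<bar>) = (\<Sum>i<n. h (t i) - h (s i))"
          by (intro sum.cong) (use st increasing_homeo_less_iff[OF h] in auto)
        also have "\<dots> = measure lborel (\<Union>i<n. {h (s i)<..<h (t i)})"
          by (rule measure_disjoint_intervals[symmetric])
             (use disjoint_family_on_image[OF h disj] st increasing_homeo_less_iff[OF h] in auto)
        also have "(\<Union>i<n. {h (s i)<..<h (t i)}) = h ` E"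
          unfolding E_def by (simp add: image_UN image_Icc_Ioo[OF h])
        also have "measure lborel (h ` E) \<le> K * (measure lborel E / (b - a)) powr \<alpha>"
          using le[OF ab E] by (simp add: K_def)
        also have "\<dots> < K * ((e / K) powr (1 / \<alpha>)) powr \<alpha>"
        proof (intro mult_strict_left_mono powr_less_mono2 K C)
          show "measure lborel E / (b - a) < (e / K) powr (1 / \<alpha>)"
            using small ab unfolding mE d_def by (simp add: divide_less_eq mult.commute)
        qed (use ab in auto)
        also have "\<dots> = e" using K e C by (simp add: powr_powr)
        finally show ?thesis .
      qed
      ultimately show "\<exists>d>0. \<forall>(n::nat) s t. (\<forall>i<n. a \<le> s i \<and> s i \<le> t i \<and> t i \<le> b) \<and>
          disjoint_family_on (\<lambda>i. {s i<..<t i}) {..<n} \<and> (\<Sum>i<n. t i - s i) < d \<longrightarrow>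
          (\<Sum>i<n. \<bar>h (t i) - h (s i)\<bar>) < e"
        by (intro exI[of _ d]) simp
    qed
  qed
qed

lemma A_infinity_homeo_imp_SQS:
  assumes A: "A_infinity_homeo h"
  shows "h \<in> SQS"
proof -
  have h: "increasing_homeo h" using A by (simp add: A_infinity_homeo_def)
  note ac = A_infinity_homeo_abs_continuous[OF A]
  obtain C \<alpha> where C: "0 < C" "0 < \<alpha>" and le0: "\<forall>a b E. a < b \<and> E \<in> sets borel \<and> E \<subseteq> {a..b} \<longrightarrow>
    measure lborel (h ` E) \<le> C * (h b - h a) * (measure lborel E / (b - a)) powr \<alpha>"
    by (rule A_infinity_homeoE[OF A])
  note le = le0[rule_format, OF conjI, OF _ conjI]
  have tot: "(LINT x:{a..b}|lebesgue. ae_deriv h x) = h b - h a" if "a \<le> b" for a b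
    using ae_deriv_integral[OF h ac, of "{a..b}" a b] measure_image_Icc[OF h that] by simp
  have weight: "is_weight (ae_deriv h)"
    unfolding is_weight_def locally_integrable_def
    using ae_deriv_measurable[OF h ac] ae_deriv_integrable[OF h ac, of "{a..b}" a b for a b]
      ae_deriv_nonneg[OF h] by auto
  have pos: "h b - h a > 0" if "a < b" for a b using that increasing_homeo_less_iff[OF h] by simp
  have main: "(LINT x:E|lebesgue. ae_deriv h x) / (LINT x:{a..b}|lebesgue. ae_deriv h x)
      \<le> C * (measure lebesgue E / (b - a)) powr \<alpha>"
    if ab: "a < b" and E: "E \<in> sets lebesgue" "E \<subseteq> {a..b}" for a b E
  proof -
    obtain F where F: "F \<in> sets borel" "F \<subseteq> E" "AE x in lebesgue. x \<in> F \<longleftrightarrow> x \<in> E"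
      using lebesgue_set_borel_part[OF E(1)] .
    have Fab: "F \<subseteq> {a..b}" using F E by auto
    have "measure lebesgue E = measure lebesgue F"
      using F E by (intro measure_eq_AE) auto
    also have "\<dots> = measure lborel F" using F(1) by (simp add: measure_completion)
    finally have mE: "measure lebesgue E = measure lborel F" .
    have "AE x in lebesgue. indicator F x *\<^sub>R ae_deriv h x = indicator E x *\<^sub>R ae_deriv h x"
      using F(3) by (rule AE_mp) (auto intro!: AE_I2 split: split_indicator)
    moreover have "set_integrable lebesgue F (ae_deriv h)"
      by (rule ae_deriv_integrable[OF h ac _ Fab]) (use F(1) in simp)
    ultimately have "(LINT x:E|lebesgue. ae_deriv h x) = (LINT x:F|lebesgue. ae_deriv h x)"
      using set_integral_cong_AE_lebesgue(2)[of F "ae_deriv h" E "ae_deriv h"] by simp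
    also have "\<dots> = measure lborel (h ` F)" by (rule ae_deriv_integral[OF h ac F(1) Fab])
    also have "\<dots> \<le> C * (h b - h a) * (measure lborel F / (b - a)) powr \<alpha>" by (rule le[OF ab F(1) Fab])
    finally show ?thesis
      unfolding tot[OF less_imp_le[OF ab]] mE using pos[OF ab] by (simp add: divide_le_eq mult_ac)
  qed
  have "A_infinity_weight (ae_deriv h)"
    unfolding A_infinity_weight_def
    using weight tot pos C main by (intro conjI exI[of _ C] exI[of _ \<alpha>]) auto
  then show ?thesis using h ac by (simp add: SQS_def)
qed

section \<open>Homeomorphisms with a power law form a group\<close>

lemma fmeasurable_image:
  assumes "increasing_homeo h" "E \<in> sets borel" "E \<subseteq> {a..b}"
  shows "h ` E \<in> fmeasurable lborel"
  by (rule fmeasurable_lborel_bounded[of _ "h a" "h b"])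
     (use assms borel_image[OF assms(1)] increasing_homeo_less_iff[OF assms(1)] in auto)

lemma measure_image_mono:
  assumes "increasing_homeo h" "E \<in> sets borel" "F \<in> sets borel" "E \<subseteq> F" "F \<subseteq> {a..b}"
  shows "measure lborel (h ` E) \<le> measure lborel (h ` F)"
  by (rule measure_mono_fmeasurable)
     (use assms fmeasurable_image[OF assms(1,3,5)] borel_image[OF assms(1,2)] in auto)

lemma A_infinity_homeo_id: "A_infinity_homeo id"
  unfolding A_infinity_homeo_def
proof (intro conjI increasing_homeo_id exI[of _ "1::real"] allI impI)
  fix a b :: real and E assume E: "a < b \<and> E \<in> sets borel \<and> E \<subseteq> {a..b}"
  then show "measure lborel (id ` E) \<le> 1 * (id b - id a) * (measure lborel E / (b - a)) powr 1"
    by simp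
qed auto

lemma A_infinity_homeo_comp:
  assumes g: "A_infinity_homeo g" and h: "A_infinity_homeo h"
  shows "A_infinity_homeo (g \<circ> h)"
proof -
  have gi: "increasing_homeo g" and hi: "increasing_homeo h"
    using g h by (auto simp: A_infinity_homeo_def)
  obtain C \<alpha> where C: "0 < C" "0 < \<alpha>" and C_le: "\<forall>a b E. a < b \<and> E \<in> sets borel \<and> E \<subseteq> {a..b} \<longrightarrow>
    measure lborel (h ` E) \<le> C * (h b - h a) * (measure lborel E / (b - a)) powr \<alpha>"
    by (rule A_infinity_homeoE[OF h])
  obtain D \<beta> where D: "0 < D" "0 < \<beta>" and D_le: "\<forall>a b E. a < b \<and> E \<in> sets borel \<and> E \<subseteq> {a..b} \<longrightarrow>
    measure lborel (g ` E) \<le> D * (g b - g a) * (measure lborel E / (b - a)) powr \<beta>"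
    by (rule A_infinity_homeoE[OF g])
  have "measure lborel ((g \<circ> h) ` E) \<le>
      D * C powr \<beta> * ((g \<circ> h) b - (g \<circ> h) a) * (measure lborel E / (b - a)) powr (\<alpha> * \<beta>)"
    if E: "a < b" "E \<in> sets borel" "E \<subseteq> {a..b}" for a b E
  proof -
    let ?x = "measure lborel E / (b - a)"
    have hab: "h a < h b" using E(1) increasing_homeo_less_iff[OF hi] by simp
    have gab: "g (h a) < g (h b)" using hab increasing_homeo_less_iff[OF gi] by simp
    have "measure lborel (h ` E) / (h b - h a) \<le> C * ?x powr \<alpha>"
      using C_le[rule_format, of a b E] E hab by (simp add: divide_le_eq mult_ac)
    then have "(measure lborel (h ` E) / (h b - h a)) powr \<beta> \<le> (C * ?x powr \<alpha>) powr \<beta>"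
      using D hab by (intro powr_mono2) auto
    also have "\<dots> = C powr \<beta> * ?x powr (\<alpha> * \<beta>)"
      using C by (simp add: powr_mult powr_powr)
    finally have le: "(measure lborel (h ` E) / (h b - h a)) powr \<beta> \<le> C powr \<beta> * ?x powr (\<alpha> * \<beta>)" .
    have "h ` E \<subseteq> {h a..h b}" using E(3) increasing_homeo_less_iff[OF hi] by auto
    then have "measure lborel (g ` (h ` E)) \<le> D * (g (h b) - g (h a)) * (measure lborel (h ` E) / (h b - h a)) powr \<beta>"
      using D_le[rule_format, of "h a" "h b" "h ` E"] hab borel_image[OF hi E(2)] by simp
    also have "\<dots> \<le> D * (g (h b) - g (h a)) * (C powr \<beta> * ?x powr (\<alpha> * \<beta>))"
      using le D gab by (intro mult_left_mono) auto
    finally show ?thesis by (simp add: image_comp mult_ac)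
  qed
  moreover have "0 < D * C powr \<beta>" "0 < \<alpha> * \<beta>" using C D by auto
  ultimately show ?thesis
    unfolding A_infinity_homeo_def using increasing_homeo_comp(1)[OF gi hi] by blast
qed

text \<open>A weak form of the power law for the inverse, by passing to complements: if the image of
  \<open>F\<close> left out too small a share of its interval, then \<open>h\<close> would map this
  remainder onto at most a twentieth of \<open>{a..b}\<close>, yet \<open>F\<close> misses at least
  a tenth. The constant 9/10 leaves room for both later uses, at density 1/2 in
  \<open>rising_sun_iteration\<close> and at density 4/5 in a doubling estimate.\<close>

lemma A_infinity_homeo_complement_bound:
  assumes A: "A_infinity_homeo h"
  obtains \<eta> where "0 < \<eta>" "\<eta> < 1"
    "\<forall>a b F. a < b \<and> F \<in> sets borel \<and> F \<subseteq> {a..b} \<and> measure lborel F \<le> 9/10 * (b - a) \<longrightarrow>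
      measure lborel (inv_into UNIV h ` F) \<le> (1 - \<eta>) * (inv_into UNIV h b - inv_into UNIV h a)"
proof -
  let ?k = "inv_into UNIV h"
  have hi: "increasing_homeo h" using A by (simp add: A_infinity_homeo_def)
  have ki: "increasing_homeo ?k" and kk: "inv_into UNIV ?k = h"
    using increasing_homeo_inv[OF hi] by auto
  note D = increasing_homeoD[OF hi]
  obtain C \<alpha> where C: "0 < C" "0 < \<alpha>" and C_le: "\<forall>a b E. a < b \<and> E \<in> sets borel \<and> E \<subseteq> {a..b} \<longrightarrow>
    measure lborel (h ` E) \<le> C * (h b - h a) * (measure lborel E / (b - a)) powr \<alpha>"
    by (rule A_infinity_homeoE[OF A])
  \<comment> \<open>Makes \<open>C * \<eta> powr \<alpha>\<close> at most 1/20, half of what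
    \<open>F\<close> is sure to miss; the 1/2 keeps \<open>\<eta>\<close> below 1.\<close>
  define \<eta> where "\<eta> = min (1/2) ((1 / (20 * C)) powr (1 / \<alpha>))"
  have \<eta>: "0 < \<eta>" "\<eta> < 1" using C unfolding \<eta>_def by auto
  have "\<eta> powr \<alpha> \<le> ((1 / (20 * C)) powr (1 / \<alpha>)) powr \<alpha>"
    using C \<eta> by (intro powr_mono2) (auto simp: \<eta>_def)
  also have "\<dots> = 1 / (20 * C)" using C by (simp add: powr_powr)
  finally have C\<eta>: "C * \<eta> powr \<alpha> \<le> 1/20" using C by (simp add: field_simps)
  have "measure lborel (?k ` F) \<le> (1 - \<eta>) * (?k b - ?k a)"
    if F: "a < b" "F \<in> sets borel" "F \<subseteq> {a..b}" "measure lborel F \<le> 9/10 * (b - a)" for a b F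
  proof (rule ccontr)
    assume contra: "\<not> ?thesis"
    let ?J = "{?k a..?k b}"
    have kab: "?k a < ?k b" using F(1) increasing_homeo_less_iff[OF ki] by simp
    let ?E = "?k ` F" and ?D = "?J - ?k ` F"
    have E: "?E \<in> sets borel" "?E \<subseteq> ?J"
      using borel_image[OF ki F(2)] F(3) increasing_homeo_less_iff[OF ki] by auto
    have Db: "?D \<in> sets borel" using E by auto
    have "measure lborel ?D = measure lborel ?J - measure lborel ?E"
      using E by (intro measurable_measure_Diff) (auto intro!: fmeasurable_lborel_bounded[of _ "?k a" "?k b"])
    then have mD: "measure lborel ?D \<le> \<eta> * (?k b - ?k a)"
      using contra kab by (simp add: algebra_simps)
    have hD: "h ` ?D = {a..b} - F"
    proof -
      have "h ` ?D = h ` ?J - h ` ?E"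
        using bij_is_inj[OF D(2)] by (rule image_set_diff)
      also have "h ` ?J = {a..b}" using image_Icc_Ioo(1)[OF hi] D(5) by simp
      also have "h ` ?E = F" using D(5) by (simp add: image_image)
      finally show ?thesis .
    qed
    have "measure lborel ({a..b} - F) = measure lborel {a..b} - measure lborel F"
      using F by (intro measurable_measure_Diff) (auto intro!: fmeasurable_lborel_bounded[of _ a b])
    then have big: "(b - a) / 10 \<le> measure lborel (h ` ?D)"
      unfolding hD using F by simp
    have "measure lborel (h ` ?D) \<le> C * (h (?k b) - h (?k a)) * (measure lborel ?D / (?k b - ?k a)) powr \<alpha>"
      using C_le kab Db by blast
    also have "\<dots> = C * (b - a) * (measure lborel ?D / (?k b - ?k a)) powr \<alpha>" by (simp only: D(5))
    also have "\<dots> \<le> C * (b - a) * \<eta> powr \<alpha>"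
      using C F(1) mD kab by (intro mult_left_mono powr_mono2) (auto simp: divide_le_eq)
    also have "\<dots> = (b - a) * (C * \<eta> powr \<alpha>)" by simp
    also have "\<dots> \<le> (b - a) * (1/20)" using C\<eta> F(1) by (intro mult_left_mono) auto
    finally show False using big F(1) by simp
  qed
  then show thesis using that[of \<eta>] \<eta> by blast
qed

text \<open>Each pass through \<open>rising_sun\<close> doubles the measure of the set and gains a
  factor \<open>1 - \<eta>\<close>. The right end point \<open>t\<close> stays, while the left one
  moves by at most twice the current measure; over \<open>n\<close> passes this sums to
  \<open>2 + 4 + ... + 2 ^ n = 2 ^ (n+1) - 2\<close> times the measure of \<open>U\<close>.\<close>

lemma rising_sun_iteration:
  assumes k: "increasing_homeo k" and \<eta>: "0 < \<eta>" "\<eta> < 1"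
    and W: "\<forall>a b F. a < b \<and> F \<in> sets borel \<and> F \<subseteq> {a..b} \<and> measure lborel F \<le> 9/10 * (b - a) \<longrightarrow>
      measure lborel (k ` F) \<le> (1 - \<eta>) * (k b - k a)"
    and U: "open U" "U \<subseteq> {s<..<t}" "s \<le> t"
  shows "measure lborel (k ` U) \<le> (1 - \<eta>) ^ n * (k t - k (s - (2 ^ (n+1) - 2) * measure lborel U))"
  using U
proof (induction n arbitrary: U s)
  case 0
  have "measure lborel (k ` U) \<le> measure lborel (k ` {s..t})"
    by (rule measure_image_mono[OF k, of _ _ s t]) (use 0 in auto)
  then show ?case using measure_image_Icc[OF k 0(3)] by simp
next
  case (Suc n)
  obtain G \<D> where G: "open G" "U \<subseteq> G" and \<D>: "countable \<D>" "disjoint \<D>" "\<Union>\<D> = G" and Gt: "G \<subseteq> {..<t}"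
    and half: "\<And>D. D \<in> \<D> \<Longrightarrow> \<exists>p q. p < q \<and> D = {p<..<q} \<and> measure lborel (U \<inter> D) = (q - p) / 2"
    and eG: "emeasure lborel G = 2 * emeasure lborel U"
    using rising_sun[OF Suc.prems(1,2)] by metis
  let ?u = "measure lborel U"
  have fU: "U \<in> fmeasurable lborel"
    by (rule fmeasurable_lborel_bounded[of _ s t]) (use Suc.prems in auto)
  have mG: "measure lborel G = 2 * ?u"
    unfolding measure_def eG by (simp add: enn2real_mult)
  \<comment> \<open>A component of \<open>G\<close> meets \<open>U\<close>, hence ends to the right
    of \<open>s\<close>, and its length is twice the measure of its part in
    \<open>U\<close>.\<close>
  have Gs: "G \<subseteq> {s - 2 * ?u<..<t}"
  proof
    fix x assume "x \<in> G"
    then obtain D where D: "D \<in> \<D>" "x \<in> D" using \<D>(3) by blast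
    obtain p q where pq: "p < q" "D = {p<..<q}" "measure lborel (U \<inter> D) = (q - p) / 2"
      using half[OF D(1)] by blast
    have "measure lborel (U \<inter> D) \<le> ?u"
      by (rule measure_mono_fmeasurable) (use fU Suc.prems(1) pq in auto)
    then have "q - p \<le> 2 * ?u" using pq(3) by simp
    moreover have "U \<inter> D \<noteq> {}" using pq by auto
    then have "s < q" using Suc.prems(2) pq(2) by auto
    ultimately show "x \<in> {s - 2 * ?u<..<t}" using D(2) pq(2) \<open>x \<in> G\<close> Gt by auto
  qed
  have fin: "emeasure (image_measure k) X = ennreal (measure lborel (k ` X))"
    if "X \<in> sets borel" "X \<subseteq> {s - 2 * ?u..t}" for X
    using emeasure_image_measure[OF k that(1)] emeasure_eq_measure2[OF fmeasurable_image[OF k that]] by simp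
  have Gsub: "G \<subseteq> {s - 2 * ?u..t}" using Gs by auto
  have "emeasure (image_measure k) U \<le> ennreal (1 - \<eta>) * emeasure (image_measure k) G"
  proof (rule emeasure_le_by_disjoint_cover[OF _ \<D>(1,2)])
    fix D assume D: "D \<in> \<D>"
    then obtain p q where pq: "p < q" "D = {p<..<q}" "measure lborel (U \<inter> D) = (q - p) / 2"
      using half by blast
    have DG: "D \<subseteq> G" using D \<D>(3) by auto
    have Db: "U \<inter> D \<in> sets borel" "U \<inter> D \<subseteq> {p..q}" using pq Suc.prems(1) by auto
    have "measure lborel (k ` (U \<inter> D)) \<le> (1 - \<eta>) * (k q - k p)"
      using W pq(1,3) Db by simp
    also have "k q - k p = measure lborel (k ` D)"
      unfolding pq(2) using pq(1) increasing_homeo_less_iff[OF k] by (simp add: image_Icc_Ioo[OF k] less_imp_le)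
    finally have "ennreal (measure lborel (k ` (U \<inter> D))) \<le> ennreal (1 - \<eta>) * ennreal (measure lborel (k ` D))"
      using \<eta> by (simp add: ennreal_mult[symmetric] ennreal_leI)
    moreover have "G \<inter> D = D" using DG by auto
    moreover have "D \<in> sets borel" "U \<inter> D \<subseteq> {s - 2 * ?u..t}" "D \<subseteq> {s - 2 * ?u..t}"
      using pq(2) DG Gsub by auto
    ultimately show "emeasure (image_measure k) (U \<inter> D) \<le> ennreal (1 - \<eta>) * emeasure (image_measure k) (G \<inter> D)"
      using fin[of "U \<inter> D"] fin[of D] Db(1) by simp
  next
    fix D assume "D \<in> \<D>"
    then show "D \<in> sets (image_measure k)" using half by fastforce
  qed (use G \<D> Suc.prems(1) in auto)
  also have "emeasure (image_measure k) G = ennreal (measure lborel (k ` G))"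
    by (rule fin) (use G Gsub in auto)
  also have "emeasure (image_measure k) U = ennreal (measure lborel (k ` U))"
    by (rule fin) (use G Gsub Suc.prems(1) in auto)
  finally have "measure lborel (k ` U) \<le> (1 - \<eta>) * measure lborel (k ` G)"
    using \<eta> by (simp add: ennreal_mult[symmetric] ennreal_le_iff)
  also have "measure lborel (k ` G) \<le>
      (1 - \<eta>) ^ n * (k t - k (s - 2 * ?u - (2 ^ (n+1) - 2) * measure lborel G))"
    by (rule Suc.IH[OF G(1) Gs]) (use Suc.prems(3) measure_nonneg[of lborel U] in linarith)
  also have "s - 2 * ?u - (2 ^ (n+1) - 2) * measure lborel G = s - (2 ^ (Suc n+1) - 2) * ?u"
    unfolding mG by (simp add: algebra_simps)
  finally show ?case using \<eta> by (simp add: mult.assoc)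
qed

lemma A_infinity_homeo_inv:
  assumes A: "A_infinity_homeo h"
  shows "A_infinity_homeo (inv_into UNIV h)"
proof -
  define k where "k = inv_into UNIV h"
  have hi: "increasing_homeo h" using A by (simp add: A_infinity_homeo_def)
  have k: "increasing_homeo k" unfolding k_def by (rule increasing_homeo_inv(1)[OF hi])
  obtain \<eta> where \<eta>: "0 < \<eta>" "\<eta> < 1" and
    W: "\<forall>a b F. a < b \<and> F \<in> sets borel \<and> F \<subseteq> {a..b} \<and> measure lborel F \<le> 9/10 * (b - a) \<longrightarrow>
      measure lborel (k ` F) \<le> (1 - \<eta>) * (k b - k a)"
    unfolding k_def by (rule A_infinity_homeo_complement_bound[OF A])
  \<comment> \<open>With the measure of \<open>F\<close> below \<open>(1/2) ^ n * L\<close>, as many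
    as \<open>n\<close> passes shift the left end point by at most \<open>2 * L\<close>, so
    everything stays inside \<open>{a - 3 * L..b + L}\<close>. The factor \<open>1 / \<eta>\<close>
    is the cost of returning from there to \<open>{a..b}\<close>.\<close>
  have step: "measure lborel (k ` F) \<le> (1 - \<eta>) ^ n * ((k b - k a) / \<eta>)"
    if F: "a < b" "F \<in> sets borel" "F \<subseteq> {a..b}" "measure lborel F < (1/2) ^ n * (b - a)" for a b F n
  proof -
    define L where "L = b - a"
    have L: "L > 0" using F(1) by (simp add: L_def)
    have fF: "F \<in> fmeasurable lborel" by (rule fmeasurable_lborel_bounded[OF F(2,3)])
    have "(1/2) ^ n * L - measure lborel F > 0" using F(4) by (simp add: L_def)
    then obtain U0 where U0: "open U0" "F \<subseteq> U0"
      "emeasure lborel (U0 - F) < ennreal ((1/2) ^ n * L - measure lborel F)"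
      by (rule outer_regular_lborel[OF F(2)])
    \<comment> \<open>An open set around \<open>F\<close> need not fit into \<open>{a..b}\<close>; a
      margin of \<open>L\<close> on both sides keeps it bounded.\<close>
    define U where "U = U0 \<inter> {a - L<..<b + L}"
    have U: "open U" "U \<subseteq> {a - L<..<b + L}" "F \<subseteq> U"
      using U0 F(3) L unfolding U_def by auto
    have fU: "U \<in> fmeasurable lborel"
      by (rule fmeasurable_lborel_bounded[of _ "a - L" "b + L"]) (use U in auto)
    have mU: "measure lborel U \<le> (1/2) ^ n * L"
    proof -
      have "emeasure lborel (U - F) \<le> emeasure lborel (U0 - F)"
        using U0(1) F(2) unfolding U_def by (intro emeasure_mono) auto
      then have "emeasure lborel (U - F) < ennreal ((1/2) ^ n * L - measure lborel F)"
        using U0(3) by simp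
      moreover have "U - F \<in> fmeasurable lborel" using fU F(2) by (intro fmeasurable_Diff) auto
      ultimately have "measure lborel (U - F) < (1/2) ^ n * L - measure lborel F"
        by (simp add: emeasure_eq_measure2 ennreal_less_iff)
      moreover have "measure lborel (U - F) = measure lborel U - measure lborel F"
        by (rule measurable_measure_Diff) (use fU F(2) U(3) in auto)
      ultimately show ?thesis by simp
    qed
    have "(2 ^ (n+1) - 2) * measure lborel U \<le> (2 ^ (n+1) - 2) * ((1/2) ^ n * L)"
      using mU by (intro mult_left_mono) (auto simp: one_le_power)
    also have "\<dots> \<le> 2 ^ (n+1) * ((1/2) ^ n * L)" using L by (intro mult_right_mono) auto
    also have "\<dots> = 2 * L" by (simp add: power_divide)
    finally have R: "a - 3 * L \<le> a - L - (2 ^ (n+1) - 2) * measure lborel U" by simp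
    have "measure lborel (k ` F) \<le> measure lborel (k ` U)"
      by (rule measure_image_mono[OF k, of _ _ "a - L" "b + L"]) (use F U in auto)
    also have "\<dots> \<le> (1 - \<eta>) ^ n * (k (b + L) - k (a - L - (2 ^ (n+1) - 2) * measure lborel U))"
      by (rule rising_sun_iteration[OF k \<eta> W U(1,2)]) (use F(1) L in simp)
    also have "\<dots> \<le> (1 - \<eta>) ^ n * (k (b + L) - k (a - 3 * L))"
      using R increasing_homeo_less_iff[OF k] \<eta> by (intro mult_left_mono) auto
    finally have le1: "measure lborel (k ` F) \<le> (1 - \<eta>) ^ n * (k (b + L) - k (a - 3 * L))" .
    \<comment> \<open>\<open>?J\<close> is one fifth of \<open>?I\<close>, so its complement in
      \<open>?I\<close> has density 4/5 and \<open>W\<close> applies to it. What the image of the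
      complement leaves out is the image of \<open>?J\<close>.\<close>
    have doubling: "\<eta> * (k (b + L) - k (a - 3 * L)) \<le> k b - k a"
    proof -
      let ?I = "{a - 3 * L..b + L}" and ?J = "{a..b}"
      have sub: "?J \<subseteq> ?I" using L by auto
      have "measure lborel (?I - ?J) = measure lborel ?I - measure lborel ?J"
        by (rule measurable_measure_Diff) (use sub in \<open>auto intro!: fmeasurable_lborel_bounded[of _ "a - 3 * L" "b + L"]\<close>)
      then have "measure lborel (?I - ?J) \<le> 9/10 * (b + L - (a - 3 * L))"
        using L F(1) by (simp add: L_def)
      then have "measure lborel (k ` (?I - ?J)) \<le> (1 - \<eta>) * (k (b + L) - k (a - 3 * L))"
        using W[rule_format, of "a - 3 * L" "b + L" "?I - ?J"] L F(1) by auto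
      moreover have "k ` (?I - ?J) = k ` ?I - k ` ?J"
        using bij_is_inj[OF increasing_homeoD(2)[OF k]] by (rule image_set_diff)
      moreover have "measure lborel (k ` ?I - k ` ?J) = measure lborel (k ` ?I) - measure lborel (k ` ?J)"
        by (rule measurable_measure_Diff)
           (use sub fmeasurable_image[OF k, of ?I] borel_image[OF k, of ?J] in auto)
      moreover have "measure lborel (k ` ?I) = k (b + L) - k (a - 3 * L)"
        using measure_image_Icc[OF k, of "a - 3 * L" "b + L"] L F(1) by simp
      moreover have "measure lborel (k ` ?J) = k b - k a"
        using measure_image_Icc[OF k, of a b] F(1) by simp
      ultimately show ?thesis by (simp add: algebra_simps)
    qed
    have "k (b + L) - k (a - 3 * L) \<le> (k b - k a) / \<eta>"
      using doubling \<eta> by (simp add: field_simps)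
    then have "(1 - \<eta>) ^ n * (k (b + L) - k (a - 3 * L)) \<le> (1 - \<eta>) ^ n * ((k b - k a) / \<eta>)"
      using \<eta> by (intro mult_left_mono) auto
    then show ?thesis using le1 by simp
  qed
  \<comment> \<open>The exponent for which halving the measure costs exactly the factor
    \<open>1 - \<eta>\<close>.\<close>
  define \<beta> where "\<beta> = - log 2 (1 - \<eta>)"
  have \<beta>: "\<beta> > 0" using \<eta> by (simp add: \<beta>_def)
  have half: "(1/2) powr \<beta> = 1 - \<eta>"
    using \<eta> by (simp add: \<beta>_def powr_divide powr_minus_divide)
  have pow: "(1 - \<eta>) ^ m = ((1/2) ^ m) powr \<beta>" for m :: nat
    by (simp add: half[symmetric] powr_power powr_realpow[symmetric] powr_powr mult.commute)
  \<comment> \<open>The factor \<open>1 / \<eta>\<close> comes from \<open>step\<close>, and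
    \<open>1 / (1 - \<eta>)\<close> from rounding the ratio \<open>r\<close> to a power of
    1/2.\<close>
  define C where "C = 1 / (\<eta> * (1 - \<eta>))"
  have C: "C > 0" "C \<ge> 1"
  proof -
    have "\<eta> * (1 - \<eta>) \<le> 1 * 1" using \<eta> by (intro mult_mono) auto
    moreover have "0 < \<eta> * (1 - \<eta>)" using \<eta> by simp
    ultimately show "C > 0" "C \<ge> 1" unfolding C_def by (auto simp: le_divide_eq)
  qed
  have "measure lborel (k ` F) \<le> C * (k b - k a) * (measure lborel F / (b - a)) powr \<beta>"
    if F: "a < b" "F \<in> sets borel" "F \<subseteq> {a..b}" for a b F
  proof -
    define r where "r = measure lborel F / (b - a)"
    have r0: "0 \<le> r" using F(1) by (simp add: r_def)
    have mF: "measure lborel F = r * (b - a)" using F(1) by (simp add: r_def)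
    have kab: "k a < k b" using F(1) increasing_homeo_less_iff[OF k] by simp
    have step': "measure lborel (k ` F) \<le> (1 - \<eta>) ^ n * ((k b - k a) / \<eta>)" if "r < (1/2) ^ n" for n
      by (rule step[OF F]) (use that F(1) in \<open>simp add: mF\<close>)
    consider "r = 0" | "0 < r" "r < 1" | "1 \<le> r" using r0 by linarith
    then have "measure lborel (k ` F) \<le> C * (k b - k a) * r powr \<beta>"
    proof cases
      case 1
      \<comment> \<open>For a null set \<open>step'\<close> holds for every \<open>n\<close>, so the
        limit 0 is a bound. It matches the right-hand side because \<open>0 powr \<beta>\<close> is
        0.\<close>
      have "(\<lambda>n. (1 - \<eta>) ^ n * ((k b - k a) / \<eta>)) \<longlonglongrightarrow> 0 * ((k b - k a) / \<eta>)"
        using \<eta> by (intro tendsto_mult LIMSEQ_power_zero tendsto_const) auto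
      then have "measure lborel (k ` F) \<le> 0 * ((k b - k a) / \<eta>)"
        by (rule LIMSEQ_le_const) (use step' 1 in auto)
      then show ?thesis using 1 by simp
    next
      case 2
      define m where "m = (LEAST m::nat. (1/2) ^ m \<le> r)"
      have ex: "\<exists>m::nat. (1/2) ^ m \<le> r"
        using real_arch_pow_inv[OF 2(1), of "1/2"] by (auto intro: less_imp_le)
      have m: "(1/2) ^ m \<le> r" unfolding m_def by (rule LeastI_ex[OF ex])
      have "m \<noteq> 0" using m 2(2) by (intro notI) simp
      then obtain n where n: "m = Suc n" by (cases m) auto
      have "\<not> (1/2) ^ n \<le> r" using not_less_Least[of n "\<lambda>m. (1/2) ^ m \<le> r"] n unfolding m_def by auto
      then have "measure lborel (k ` F) \<le> (1 - \<eta>) ^ n * ((k b - k a) / \<eta>)" by (intro step') simp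
      also have "\<dots> = C * (k b - k a) * (1 - \<eta>) ^ m"
        using \<eta> unfolding n C_def by (simp add: field_simps)
      also have "\<dots> \<le> C * (k b - k a) * r powr \<beta>"
        unfolding pow using m \<beta> C kab by (intro mult_left_mono powr_mono2) auto
      finally show ?thesis .
    next
      case 3
      have "measure lborel (k ` F) \<le> measure lborel (k ` {a..b})"
        by (rule measure_image_mono[OF k F(2) _ F(3), of a b]) auto
      also have "\<dots> = k b - k a" using measure_image_Icc[OF k] F(1) by simp
      also have "\<dots> \<le> C * (k b - k a) * r powr \<beta>"
      proof -
        have "1 * (k b - k a) * 1 \<le> C * (k b - k a) * r powr \<beta>"
          using C kab 3 \<beta> by (intro mult_mono) (auto simp: ge_one_powr_ge_zero)
        then show ?thesis by simp
      qed
      finally show ?thesis .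
    qed
    then show ?thesis by (simp add: r_def)
  qed
  then show ?thesis
    unfolding A_infinity_homeo_def k_def[symmetric] using k C(1) \<beta> by blast
qed

section \<open>The John-Nirenberg inequality\<close>

text \<open>The constants \<open>c a b\<close> are arbitrary, not means of \<open>u\<close>. Weak
  bounds on two nested intervals force their constants to be within \<open>2 * l\<close> of each
  other as soon as some point is good for both, whence the thresholds
  \<open>(2 * n + 1) * l\<close>. Raising the threshold by \<open>2 * l\<close> confines the bad set
  to pieces of total length at most \<open>L / 2\<close>, with \<open>L\<close> the length of the
  interval, and the induction hypothesis applies on each piece.\<close>

lemma john_nirenberg_level_sets:
  fixes u :: "real \<Rightarrow> real" and c :: "real \<Rightarrow> real \<Rightarrow> real"
  assumes u[measurable]: "u \<in> borel_measurable borel" and l: "0 < l"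
    and base: "\<And>a b. a < b \<Longrightarrow> b - a \<le> r \<Longrightarrow>
      measure lborel {x \<in> {a<..<b}. \<bar>u x - c a b\<bar> > l} \<le> (b - a) / 16"
    and ab: "a < b" "b - a \<le> r"
  shows "measure lborel {x \<in> {a<..<b}. \<bar>u x - c a b\<bar> > (2 * real n + 1) * l} \<le> (1/2) ^ n / 16 * (b - a)"
  using ab
proof (induction n arbitrary: a b)
  case 0
  then show ?case using base[of a b] by simp
next
  case (Suc n)
  define L where "L = b - a"
  have L: "L > 0" using Suc.prems by (simp add: L_def)
  have lev: "{x \<in> {a<..<b}. \<bar>u x - e\<bar> > t} \<in> sets borel" for a b e t by measurable
  have flev: "{x \<in> {a<..<b}. \<bar>u x - e\<bar> > t} \<in> fmeasurable lborel" for a b e t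
    by (rule fmeasurable_lborel_bounded[OF lev, of _ _ _ _ a b]) auto
  define E where "E = {x \<in> {a<..<b}. \<bar>u x - c a b\<bar> > l}"
  define A where "A = {x \<in> {a<..<b}. \<bar>u x - c a b\<bar> > (2 * real (Suc n) + 1) * l}"
  have Eb: "E \<in> sets borel" and Ab: "A \<in> sets borel" unfolding E_def A_def by (rule lev)+
  have "l \<le> (2 * real (Suc n) + 1) * l" using l by (simp add: algebra_simps)
  then have AE: "A \<subseteq> E" unfolding E_def A_def by auto
  have mE: "measure lborel E \<le> L / 16" unfolding E_def L_def by (rule base[OF Suc.prems])
  \<comment> \<open>An excess of \<open>L / 16\<close> over the measure of \<open>E\<close> gives
    \<open>U\<close> measure at most \<open>L / 8\<close>, hence \<open>G\<close> at most
    \<open>L / 4\<close>.\<close>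
  have "L / 16 > 0" using L by simp
  then obtain U0 where U0: "open U0" "E \<subseteq> U0" "emeasure lborel (U0 - E) < ennreal (L / 16)"
    by (rule outer_regular_lborel[OF Eb])
  define U where "U = U0 \<inter> {a<..<b}"
  have U: "open U" "U \<subseteq> {a<..<b}" "E \<subseteq> U" using U0 unfolding U_def E_def by auto
  have fU: "U \<in> fmeasurable lborel"
    by (rule fmeasurable_lborel_bounded[of _ a b]) (use U in auto)
  have mU: "measure lborel U \<le> L / 8"
  proof -
    have "emeasure lborel (U - E) \<le> emeasure lborel (U0 - E)"
      using U0(1) Eb unfolding U_def by (intro emeasure_mono) auto
    then have "emeasure lborel (U - E) < ennreal (L / 16)" using U0(3) by simp
    moreover have "U - E \<in> fmeasurable lborel" using fU Eb by (intro fmeasurable_Diff) auto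
    ultimately have "measure lborel (U - E) < L / 16"
      using L by (simp add: emeasure_eq_measure2 ennreal_less_iff)
    moreover have "measure lborel (U - E) = measure lborel U - measure lborel E"
      by (rule measurable_measure_Diff) (use fU Eb U(3) in auto)
    ultimately show ?thesis using mE by simp
  qed
  obtain G \<D> where G: "open G" "U \<subseteq> G" and \<D>: "countable \<D>" "disjoint \<D>" "\<Union>\<D> = G" and Gb: "G \<subseteq> {..<b}"
    and half: "\<And>D. D \<in> \<D> \<Longrightarrow> \<exists>p q. p < q \<and> D = {p<..<q} \<and> measure lborel (U \<inter> D) = (q - p) / 2"
    and eG: "emeasure lborel G = 2 * emeasure lborel U"
    using rising_sun[OF U(1,2)] by metis
  define \<kappa> where "\<kappa> = (1/2::real) ^ n / 16"
  have \<kappa>: "\<kappa> > 0" by (simp add: \<kappa>_def)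
  \<comment> \<open>If at most half of \<open>(p, q)\<close> is bad for \<open>c a b\<close>, then \<open>c p q\<close> differs from \<open>c a b\<close> by at most \<open>2 l\<close>.\<close>
  have sub: "measure lborel (A \<inter> {p<..<q}) \<le> \<kappa> * (q - p)"
    if pq: "p < q" "a \<le> p" "q \<le> b" and Upq: "measure lborel (U \<inter> {p<..<q}) \<le> (q - p) / 2" for p q
  proof -
    have len: "q - p \<le> r" using pq Suc.prems by simp
    let ?B = "{x \<in> {p<..<q}. \<bar>u x - c p q\<bar> > l}"
    have "measure lborel ((U \<inter> {p<..<q}) \<union> ?B) \<le> measure lborel (U \<inter> {p<..<q}) + measure lborel ?B"
      using fU lev by (intro measure_Un_le) auto
    also have "\<dots> \<le> (q - p) / 2 + (q - p) / 16" by (intro add_mono Upq base pq len)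
    also have "\<dots> < measure lborel {p<..<q}" using pq by simp
    finally have less: "measure lborel ((U \<inter> {p<..<q}) \<union> ?B) < measure lborel {p<..<q}" .
    \<comment> \<open>The two bad sets occupy at most \<open>1/2 + 1/16\<close> of the interval, so
      a point good for both constants is left.\<close>
    have "\<exists>x \<in> {p<..<q}. x \<notin> U \<and> x \<notin> ?B"
    proof (rule ccontr)
      assume "\<not> ?thesis"
      then have "{p<..<q} = (U \<inter> {p<..<q}) \<union> ?B" by auto
      then show False using less by simp
    qed
    then obtain x where x: "x \<in> {p<..<q}" "x \<notin> U" "x \<notin> ?B" by blast
    then have "\<bar>u x - c p q\<bar> \<le> l" by auto
    moreover have "\<bar>u x - c a b\<bar> \<le> l"
    proof -
      have "x \<notin> E" using x U by auto
      then show ?thesis using x(1) pq unfolding E_def by auto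
    qed
    ultimately have cc: "\<bar>c p q - c a b\<bar> \<le> 2 * l" by linarith
    have "A \<inter> {p<..<q} \<subseteq> {x \<in> {p<..<q}. \<bar>u x - c p q\<bar> > (2 * real n + 1) * l}"
    proof
      fix y assume y: "y \<in> A \<inter> {p<..<q}"
      then have "\<bar>u y - c a b\<bar> > (2 * real n + 1) * l + 2 * l"
        unfolding A_def by (simp add: algebra_simps)
      then have "\<bar>u y - c p q\<bar> > (2 * real n + 1) * l" using cc by linarith
      then show "y \<in> {x \<in> {p<..<q}. \<bar>u x - c p q\<bar> > (2 * real n + 1) * l}" using y by simp
    qed
    then have "measure lborel (A \<inter> {p<..<q}) \<le> measure lborel {x \<in> {p<..<q}. \<bar>u x - c p q\<bar> > (2 * real n + 1) * l}"
      using Ab by (intro measure_mono_fmeasurable flev) auto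
    also have "\<dots> \<le> \<kappa> * (q - p)" unfolding \<kappa>_def by (rule Suc.IH[OF pq(1) len])
    finally show ?thesis .
  qed
  have fA: "A \<inter> X \<in> fmeasurable lborel" if "X \<in> sets borel" for X
    by (rule fmeasurable_lborel_bounded[of _ a b]) (use Ab that in \<open>auto simp: A_def\<close>)
  have uU: "emeasure lborel U = ennreal (measure lborel U)" using fU by (rule emeasure_eq_measure2)
  \<comment> \<open>Only components inside \<open>{a<..<b}\<close> are subintervals to which
    \<open>sub\<close> applies. They have total length at most \<open>L / 4\<close>.\<close>
  define \<D>' where "\<D>' = {D \<in> \<D>. D \<subseteq> {a<..<b}}"
  have \<D>': "countable \<D>'" "disjoint \<D>'" "\<And>D. D \<in> \<D>' \<Longrightarrow> D \<in> \<D>"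
    using \<D>(1,2) unfolding \<D>'_def by (auto simp: disjoint_def intro: countable_subset[of _ \<D>])
  have Db: "D \<in> sets borel" if "D \<in> \<D>" for D using half[OF that] by (elim exE conjE) simp
  have W: "\<Union>\<D>' \<in> sets borel" using \<D>' Db by (intro sets.countable_Union) auto
  have "emeasure lborel (A \<inter> \<Union>\<D>') \<le> ennreal \<kappa> * emeasure lborel G"
  proof (rule emeasure_le_by_disjoint_cover[OF _ \<D>'(1,2)])
    fix D assume D: "D \<in> \<D>'"
    obtain p q where pq: "p < q" "D = {p<..<q}" "measure lborel (U \<inter> D) = (q - p) / 2"
      using half[OF \<D>'(3)[OF D]] by blast
    have "{p<..<q} \<subseteq> {a<..<b}" using D pq(2) unfolding \<D>'_def by auto
    then have "a \<le> p" "q \<le> b" using pq(1) unfolding greaterThanLessThan_subseteq_greaterThanLessThan by auto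
    then have "measure lborel (A \<inter> D) \<le> \<kappa> * (q - p)"
      using sub[OF pq(1)] pq(2,3) by simp
    then have "emeasure lborel (A \<inter> D) \<le> ennreal (\<kappa> * (q - p))"
      using emeasure_eq_measure2[OF fA[OF Db[OF \<D>'(3)[OF D]]]] by (simp add: ennreal_leI)
    also have "\<dots> = ennreal \<kappa> * emeasure lborel D"
      using \<kappa> pq(1) unfolding pq(2) by (simp add: ennreal_mult)
    finally have "emeasure lborel (A \<inter> D) \<le> ennreal \<kappa> * emeasure lborel D" .
    moreover have "G \<inter> D = D" "A \<inter> \<Union>\<D>' \<inter> D = A \<inter> D" using \<D>(3) \<D>'(3)[OF D] D by auto
    ultimately show "emeasure lborel (A \<inter> \<Union>\<D>' \<inter> D) \<le> ennreal \<kappa> * emeasure lborel (G \<inter> D)" by simp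
  qed (use \<D>' Db W Ab G in auto)
  also have "\<dots> = ennreal (\<kappa> * (2 * measure lborel U))"
    using \<kappa> unfolding eG uU by (simp add: ennreal_mult)
  finally have "measure lborel (A \<inter> \<Union>\<D>') \<le> \<kappa> * (2 * measure lborel U)"
    using emeasure_eq_measure2[OF fA[OF W]] \<kappa> by (simp add: ennreal_le_iff)
  also have "\<dots> \<le> \<kappa> * (L / 4)" using mU \<kappa> by (intro mult_left_mono) auto
  finally have part1: "measure lborel (A \<inter> \<Union>\<D>') \<le> \<kappa> * (L / 4)" .
  \<comment> \<open>Not a component, but an interval of twice the largest possible measure of
    \<open>U\<close>; this is all that \<open>sub\<close> asks of it.\<close>
  let ?I = "{a<..<a + L / 4}"
  have aL: "a + L / 4 \<le> b" using Suc.prems(1) by (simp add: L_def field_simps)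
  have "measure lborel (U \<inter> ?I) \<le> measure lborel U"
    by (rule measure_mono_fmeasurable) (use fU U(1) in auto)
  then have part2: "measure lborel (A \<inter> ?I) \<le> \<kappa> * (L / 4)"
    using sub[of a "a + L / 4"] mU L aL by simp
  \<comment> \<open>The component that sticks out to the left of \<open>a\<close> has length at most \<open>L / 4\<close>.\<close>
  have cover: "A \<subseteq> (A \<inter> \<Union>\<D>') \<union> (A \<inter> ?I)"
  proof
    fix x assume x: "x \<in> A"
    then have "x \<in> G" using AE U(3) G(2) by auto
    then obtain D where D: "D \<in> \<D>" "x \<in> D" using \<D>(3) by blast
    obtain p q where pq: "p < q" "D = {p<..<q}" "measure lborel (U \<inter> D) = (q - p) / 2"
      using half[OF D(1)] by blast
    have "{p<..<q} \<subseteq> {..<b}" using D(1) pq(2) \<D>(3) Gb by auto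
    then have "q \<le> b" using pq(1) dense[of "max p b" q] by (force simp: not_less[symmetric])
    have "measure lborel (U \<inter> D) \<le> measure lborel U"
      by (rule measure_mono_fmeasurable) (use fU U(1) pq in auto)
    then have len: "q - p \<le> L / 4" using pq(3) mU by simp
    show "x \<in> (A \<inter> \<Union>\<D>') \<union> (A \<inter> ?I)"
    proof (cases "a \<le> p")
      case True
      then have "D \<in> \<D>'" using D(1) pq(2) \<open>q \<le> b\<close> unfolding \<D>'_def by auto
      then show ?thesis using x D(2) by auto
    next
      case False
      have "a < x" using x unfolding A_def by simp
      moreover have "x < a + L / 4" using D(2) pq(2) False len by simp
      ultimately show ?thesis using x by simp
    qed
  qed
  have "measure lborel A \<le> measure lborel ((A \<inter> \<Union>\<D>') \<union> (A \<inter> ?I))"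
    using cover Ab W fA by (intro measure_mono_fmeasurable fmeasurable.Un) auto
  also have "\<dots> \<le> measure lborel (A \<inter> \<Union>\<D>') + measure lborel (A \<inter> ?I)"
    using Ab W by (intro measure_Un_le) auto
  \<comment> \<open>Two pieces of a quarter each: this is the factor 1/2 gained per step.\<close>
  also have "\<dots> \<le> \<kappa> * (L / 4) + \<kappa> * (L / 4)" by (rule add_mono[OF part1 part2])
  also have "\<dots> = (1/2) ^ Suc n / 16 * (b - a)" by (simp add: \<kappa>_def L_def)
  finally show ?case unfolding A_def .
qed

text \<open>If exactly \<open>m\<close> of the thresholds are exceeded, then \<open>t\<close> is at
  most the next one, \<open>(2 * m + 1) * l = l + m * (2 * l)\<close>. In \<open>ennreal\<close> the
  series has a value without a convergence proof.\<close>

lemma layer_cake_bound: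
  assumes "0 < l"
  shows "ennreal t \<le> ennreal l + (\<Sum>n. ennreal (2 * l) * indicator {(2 * real n + 1) * l<..} t)"
proof -
  define m where "m = (LEAST m::nat. t \<le> (2 * real m + 1) * l)"
  have ex: "\<exists>m::nat. t \<le> (2 * real m + 1) * l"
  proof -
    obtain m :: nat where "t / l < real m" using reals_Archimedean2 by blast
    then have "t < real m * l" using assms by (simp add: divide_less_eq)
    also have "\<dots> \<le> (2 * real m + 1) * l" using assms by (intro mult_right_mono) auto
    finally show ?thesis by (intro exI[of _ m]) simp
  qed
  have m: "t \<le> (2 * real m + 1) * l" unfolding m_def by (rule LeastI_ex[OF ex])
  have less: "(2 * real n + 1) * l < t" if "n < m" for n
    using not_less_Least[of n "\<lambda>m. t \<le> (2 * real m + 1) * l"] that unfolding m_def by simp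
  have "ennreal t \<le> ennreal (l + real m * (2 * l))"
    using m by (intro ennreal_leI) (simp add: algebra_simps)
  also have "\<dots> = ennreal l + ennreal (real m * (2 * l))" using assms by (intro ennreal_plus) auto
  also have "ennreal (real m * (2 * l)) = (\<Sum>n<m. ennreal (2 * l))"
    using assms by (simp add: ennreal_mult ennreal_of_nat_eq_real_of_nat)
  also have "\<dots> = (\<Sum>n<m. ennreal (2 * l) * indicator {(2 * real n + 1) * l<..} t)"
    using less by (intro sum.cong) auto
  also have "\<dots> \<le> (\<Sum>n. ennreal (2 * l) * indicator {(2 * real n + 1) * l<..} t)"
    by (intro sum_le_suminf) auto
  finally show ?thesis by (simp add: add_left_mono)
qed

lemma john_nirenberg_integral:
  fixes u :: "real \<Rightarrow> real" and c :: "real \<Rightarrow> real \<Rightarrow> real"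
  assumes u[measurable]: "u \<in> borel_measurable borel" and l: "0 < l"
    and base: "\<And>a b. a < b \<Longrightarrow> b - a \<le> r \<Longrightarrow>
      measure lborel {x \<in> {a<..<b}. \<bar>u x - c a b\<bar> > l} \<le> (b - a) / 16"
    and ab: "a < b" "b - a \<le> r"
  shows "(\<integral>\<^sup>+x. ennreal \<bar>u x - c a b\<bar> * indicator {a<..<b} x \<partial>lborel) \<le> ennreal (2 * l * (b - a))"
proof -
  let ?A = "\<lambda>n. {x \<in> {a<..<b}. \<bar>u x - c a b\<bar> > (2 * real n + 1) * l}"
  have Ab: "?A n \<in> sets borel" for n by measurable
  have fA: "?A n \<in> fmeasurable lborel" for n
    by (rule fmeasurable_lborel_bounded[OF Ab, of _ a b]) auto
  have "(\<integral>\<^sup>+x. ennreal \<bar>u x - c a b\<bar> * indicator {a<..<b} x \<partial>lborel)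
      \<le> (\<integral>\<^sup>+x. ennreal l * indicator {a<..<b} x + (\<Sum>n. ennreal (2 * l) * indicator (?A n) x) \<partial>lborel)"
  proof (rule nn_integral_mono)
    fix x
    show "ennreal \<bar>u x - c a b\<bar> * indicator {a<..<b} x
        \<le> ennreal l * indicator {a<..<b} x + (\<Sum>n. ennreal (2 * l) * indicator (?A n) x)"
    proof (cases "x \<in> {a<..<b}")
      case True
      then have "indicator (?A n) x = (indicator {(2 * real n + 1) * l<..} \<bar>u x - c a b\<bar> :: ennreal)" for n
        by (simp split: split_indicator)
      then show ?thesis using layer_cake_bound[OF l, of "\<bar>u x - c a b\<bar>"] True by simp
    qed simp
  qed
  also have "\<dots> = ennreal l * emeasure lborel {a<..<b} + (\<Sum>n. ennreal (2 * l) * emeasure lborel (?A n))"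
    using Ab by (subst nn_integral_add, simp, simp, subst nn_integral_suminf)
      (simp_all add: nn_integral_cmult_indicator)
  also have "\<dots> \<le> ennreal l * emeasure lborel {a<..<b} + (\<Sum>n. ennreal (2 * l * ((b - a) / 16) * (1/2) ^ n))"
  proof (intro add_left_mono suminf_le)
    fix n
    have "ennreal (2 * l) * emeasure lborel (?A n) = ennreal (2 * l * measure lborel (?A n))"
      using l emeasure_eq_measure2[OF fA[of n]] by (simp add: ennreal_mult)
    also have "\<dots> \<le> ennreal (2 * l * ((1/2) ^ n / 16 * (b - a)))"
      using l john_nirenberg_level_sets[OF u l base ab, of n] by (intro ennreal_leI mult_left_mono) auto
    also have "2 * l * ((1/2) ^ n / 16 * (b - a)) = 2 * l * ((b - a) / 16) * (1/2) ^ n" by simp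
    finally show "ennreal (2 * l) * emeasure lborel (?A n) \<le> ennreal (2 * l * ((b - a) / 16) * (1/2) ^ n)" .
  qed auto
  also have "(\<Sum>n. ennreal (2 * l * ((b - a) / 16) * (1/2) ^ n)) = ennreal (2 * l * ((b - a) / 16) * 2)"
  proof (rule suminf_ennreal_eq)
    have "(\<lambda>n. (1/2::real) ^ n) sums 2" using geometric_sums[of "1/2::real"] by simp
    then show "(\<lambda>n. 2 * l * ((b - a) / 16) * (1/2) ^ n) sums (2 * l * ((b - a) / 16) * 2)"
      by (rule sums_mult)
  qed (use l ab in auto)
  also have "ennreal l * emeasure lborel {a<..<b} = ennreal (l * (b - a))"
    using l ab by (simp add: ennreal_mult)
  also have "ennreal (l * (b - a)) + ennreal (2 * l * ((b - a) / 16) * 2) = ennreal (l * (b - a) + 2 * l * ((b - a) / 16) * 2)"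
    using l ab by (intro ennreal_plus[symmetric]) auto
  also have "\<dots> \<le> ennreal (2 * l * (b - a))"
  \<comment> \<open>The levels contribute a quarter of \<open>l * (b - a)\<close>, so the total is
    5/4 of it; the constant 2 in the statement is generous.\<close>
  proof (rule ennreal_leI)
    have "0 < l * (b - a)" using l ab by simp
    moreover have "2 * l * ((b - a) / 16) * 2 = l * (b - a) / 4" "2 * l * (b - a) = 2 * (l * (b - a))"
      by simp_all
    ultimately show "l * (b - a) + 2 * l * ((b - a) / 16) * 2 \<le> 2 * l * (b - a)" by linarith
  qed
  finally show ?thesis .
qed

section \<open>Composition in VMO\<close>

lemma set_integrable_const_Icc: "set_integrable lebesgue {a..b} (\<lambda>x::real. c::real)"
  by (intro absolutely_integrable_continuous_real continuous_intros)

lemma set_integral_const_Icc: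
  assumes "a \<le> b"
  shows "(LINT x:{a..b}|lebesgue. c) = c * (b - a :: real)"
  using assms by (simp add: set_lebesgue_integral_def mult.commute)

lemma set_integrable_abs_diff_const:
  assumes "set_integrable lebesgue {a..b} u"
  shows "set_integrable lebesgue {a..b} (\<lambda>x::real. u x - c :: real)"
    "set_integrable lebesgue {a..b} (\<lambda>x. \<bar>u x - c\<bar>)"
proof -
  show *: "set_integrable lebesgue {a..b} (\<lambda>x. u x - c)"
    by (rule set_integral_diff(1)[OF assms set_integrable_const_Icc])
  show "set_integrable lebesgue {a..b} (\<lambda>x. \<bar>u x - c\<bar>)"
    using set_integrable_abs[OF *] .
qed

text \<open>The mean is itself within \<open>K\<close> of \<open>c\<close>, so replacing
  \<open>c\<close> by the mean at most doubles the average deviation.\<close>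

lemma mean_oscillation_le_of_deviation:
  assumes ab: "a < b" and u: "set_integrable lebesgue {a..b} u"
    and K: "(LINT x:{a..b}|lebesgue. \<bar>u x - c\<bar>) \<le> K * (b - a)"
  shows "mean_oscillation u a b \<le> 2 * K"
proof -
  define m where "m = interval_mean u a b"
  have "(LINT x:{a..b}|lebesgue. u x - c) = (LINT x:{a..b}|lebesgue. u x) - c * (b - a)"
    using set_integral_diff(2)[OF u set_integrable_const_Icc] set_integral_const_Icc[of a b c] ab by simp
  then have eq: "(LINT x:{a..b}|lebesgue. u x - c) = (m - c) * (b - a)"
    using ab unfolding m_def interval_mean_def by (simp add: left_diff_distrib)
  have "\<bar>LINT x:{a..b}|lebesgue. u x - c\<bar> \<le> (LINT x:{a..b}|lebesgue. \<bar>u x - c\<bar>)"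
    using set_integral_norm_bound[OF set_integrable_abs_diff_const(1)[OF u]] by simp
  also have "\<bar>LINT x:{a..b}|lebesgue. u x - c\<bar> = \<bar>m - c\<bar> * (b - a)"
    unfolding eq using ab by (simp add: abs_mult)
  finally have "\<bar>m - c\<bar> * (b - a) \<le> K * (b - a)" using K by linarith
  then have mc: "\<bar>m - c\<bar> \<le> K" using ab by simp
  have "(LINT x:{a..b}|lebesgue. \<bar>u x - m\<bar>) \<le> (LINT x:{a..b}|lebesgue. \<bar>u x - c\<bar> + \<bar>c - m\<bar>)"
    by (intro set_integral_mono set_integrable_abs_diff_const u set_integral_add(1) set_integrable_const_Icc) auto
  also have "\<dots> = (LINT x:{a..b}|lebesgue. \<bar>u x - c\<bar>) + \<bar>c - m\<bar> * (b - a)"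
    using set_integral_add(2)[OF set_integrable_abs_diff_const(2)[OF u] set_integrable_const_Icc]
      set_integral_const_Icc[of a b "\<bar>c - m\<bar>"] ab by simp
  also have "\<dots> \<le> K * (b - a) + K * (b - a)"
    using K mc ab by (intro add_mono mult_right_mono) auto
  finally have "(LINT x:{a..b}|lebesgue. \<bar>u x - m\<bar>) \<le> 2 * K * (b - a)" by simp
  then show ?thesis unfolding mean_oscillation_def m_def[symmetric] using ab by (simp add: field_simps)
qed

lemma mean_oscillation_integral:
  assumes "a < b"
  shows "(LINT x:{a..b}|lebesgue. \<bar>u x - interval_mean u a b\<bar>) = mean_oscillation u a b * (b - a)"
  using assms by (simp add: mean_oscillation_def)

lemma mean_oscillation_cong_AE:
  assumes u: "set_integrable lebesgue {a..b} u" and ae: "AE x in lebesgue. u x = v x"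
  shows "set_integrable lebesgue {a..b} v" "mean_oscillation v a b = mean_oscillation u a b"
proof -
  have *: "AE x in lebesgue. indicator {a..b} x *\<^sub>R u x = indicator {a..b} x *\<^sub>R v x"
    using ae by (rule AE_mp) (auto intro!: AE_I2)
  show "set_integrable lebesgue {a..b} v" by (rule set_integral_cong_AE_lebesgue(1)[OF u *])
  have m: "interval_mean v a b = interval_mean u a b"
    unfolding interval_mean_def using set_integral_cong_AE_lebesgue(2)[OF u *] by simp
  have "AE x in lebesgue. indicator {a..b} x *\<^sub>R \<bar>u x - interval_mean u a b\<bar> = indicator {a..b} x *\<^sub>R \<bar>v x - interval_mean u a b\<bar>"
    using ae by (rule AE_mp) (auto intro!: AE_I2)
  from set_integral_cong_AE_lebesgue(2)[OF set_integrable_abs_diff_const(2)[OF u] this]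
  show "mean_oscillation v a b = mean_oscillation u a b"
    unfolding mean_oscillation_def m by simp
qed

section \<open>VMO under sums, negation and change on null sets\<close>

lemma VMO_iff:
  "u \<in> VMO \<longleftrightarrow> (\<forall>a b. set_integrable lebesgue {a..b} u) \<and>
     (\<exists>B. \<forall>a b. a < b \<longrightarrow> mean_oscillation u a b \<le> B) \<and>
     (\<forall>\<epsilon>>0. \<exists>\<delta>>0. \<forall>a b. a < b \<and> b - a < \<delta> \<longrightarrow> mean_oscillation u a b < \<epsilon>)"
  unfolding VMO_def BMO_def locally_integrable_def bdd_above_def by blast

lemma VMO_cong_AE:
  assumes u: "u \<in> VMO" and ae: "AE x in lebesgue. u x = v x"
  shows "v \<in> VMO"
proof -
  have int: "set_integrable lebesgue {a..b} u" for a b using u by (simp add: VMO_iff)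
  note c = mean_oscillation_cong_AE[OF int ae]
  show ?thesis using u c(1) unfolding VMO_iff c(2) by blast
qed

lemma VMO_zero: "(\<lambda>_. 0) \<in> VMO"
  by (auto simp: VMO_iff mean_oscillation_def interval_mean_def set_lebesgue_integral_def
      intro: set_integrable_const_Icc exI[of _ 1])

lemma VMO_uminus:
  assumes "u \<in> VMO"
  shows "(\<lambda>x. - u x) \<in> VMO"
proof -
  have m: "interval_mean (\<lambda>x. - u x) a b = - interval_mean u a b" for a b
    unfolding interval_mean_def set_lebesgue_integral_def by simp
  have *: "\<bar>- x - - y\<bar> = \<bar>x - y\<bar>" for x y :: real by simp
  have "mean_oscillation (\<lambda>x. - u x) a b = mean_oscillation u a b" for a b
    unfolding mean_oscillation_def m by (simp only: *)
  moreover have "set_integrable lebesgue {a..b} (\<lambda>x. - u x)" for a b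
    using assms unfolding VMO_iff set_integrable_def by simp
  ultimately show ?thesis using assms unfolding VMO_iff by simp
qed

lemma mean_oscillation_add:
  assumes ab: "a < b" and u: "set_integrable lebesgue {a..b} u" and v: "set_integrable lebesgue {a..b} v"
  shows "mean_oscillation (\<lambda>x. u x + v x) a b \<le> mean_oscillation u a b + mean_oscillation v a b"
proof -
  let ?m = "interval_mean u a b" and ?n = "interval_mean v a b"
  have m: "interval_mean (\<lambda>x. u x + v x) a b = ?m + ?n"
    unfolding interval_mean_def set_integral_add(2)[OF u v] by (simp add: algebra_simps)
  have uv: "set_integrable lebesgue {a..b} (\<lambda>x. u x + v x)" by (rule set_integral_add(1)[OF u v])
  have "(LINT x:{a..b}|lebesgue. \<bar>u x + v x - (?m + ?n)\<bar>) \<le> (LINT x:{a..b}|lebesgue. \<bar>u x - ?m\<bar> + \<bar>v x - ?n\<bar>)"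
    by (intro set_integral_mono set_integrable_abs_diff_const set_integral_add(1) u v) auto
  also have "\<dots> = (LINT x:{a..b}|lebesgue. \<bar>u x - ?m\<bar>) + (LINT x:{a..b}|lebesgue. \<bar>v x - ?n\<bar>)"
    by (intro set_integral_add(2) set_integrable_abs_diff_const u v)
  finally show ?thesis
    unfolding mean_oscillation_def m distrib_left[symmetric] using ab by (intro mult_left_mono) auto
qed

lemma VMO_add:
  assumes u: "u \<in> VMO" and v: "v \<in> VMO"
  shows "(\<lambda>x. u x + v x) \<in> VMO"
proof -
  have ui: "set_integrable lebesgue {a..b} u" and vi: "set_integrable lebesgue {a..b} v" for a b
    using u v by (auto simp: VMO_iff)
  note osc = mean_oscillation_add[OF _ ui vi]
  obtain B1 B2 where B: "\<And>a b. a < b \<Longrightarrow> mean_oscillation u a b \<le> B1" "\<And>a b. a < b \<Longrightarrow> mean_oscillation v a b \<le> B2"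
    using u v unfolding VMO_iff by metis
  show ?thesis
    unfolding VMO_iff
  proof (intro conjI allI impI)
    show "set_integrable lebesgue {a..b} (\<lambda>x. u x + v x)" for a b by (rule set_integral_add(1)[OF ui vi])
    show "\<exists>B. \<forall>a b. a < b \<longrightarrow> mean_oscillation (\<lambda>x. u x + v x) a b \<le> B"
      using osc B by (intro exI[of _ "B1 + B2"]) (meson add_mono order_trans)
    fix e :: real assume "0 < e"
    then have "0 < e / 2" by simp
    obtain d1 where d1: "d1 > 0" "\<And>a b. a < b \<Longrightarrow> b - a < d1 \<Longrightarrow> mean_oscillation u a b < e / 2"
      using u \<open>0 < e / 2\<close> unfolding VMO_iff by meson
    obtain d2 where d2: "d2 > 0" "\<And>a b. a < b \<Longrightarrow> b - a < d2 \<Longrightarrow> mean_oscillation v a b < e / 2"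
      using v \<open>0 < e / 2\<close> unfolding VMO_iff by meson
    have "mean_oscillation (\<lambda>x. u x + v x) a b < e" if "a < b" "b - a < min d1 d2" for a b
      using osc[OF that(1)] d1(2)[of a b] d2(2)[of a b] that by simp
    then show "\<exists>d>0. \<forall>a b. a < b \<and> b - a < d \<longrightarrow> mean_oscillation (\<lambda>x. u x + v x) a b < e"
      using d1(1) d2(1) by (intro exI[of _ "min d1 d2"]) auto
  qed
qed

text \<open>For a composed function integrability is not known in advance. It is read off here from
  the finite non-negative integral that John-Nirenberg provides; passing between open and closed
  interval changes only two points.\<close>

lemma set_integral_le_of_nn_integral:
  fixes v :: "real \<Rightarrow> real"
  assumes v[measurable]: "v \<in> borel_measurable borel" and K: "0 \<le> K"
    and nn: "(\<integral>\<^sup>+x. ennreal \<bar>v x - c\<bar> * indicator {a<..<b} x \<partial>lborel) \<le> ennreal K"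
  shows "set_integrable lebesgue {a..b} v" "(LINT x:{a..b}|lebesgue. \<bar>v x - c\<bar>) \<le> K"
proof -
  let ?f = "\<lambda>x. indicator {a..b} x *\<^sub>R (v x - c)"
  have "(\<integral>\<^sup>+x. ennreal (norm (?f x)) \<partial>lborel) = (\<integral>\<^sup>+x. ennreal \<bar>v x - c\<bar> * indicator {a<..<b} x \<partial>lborel)"
  proof (rule nn_integral_cong_AE)
    show "AE x in lborel. ennreal (norm (?f x)) = ennreal \<bar>v x - c\<bar> * indicator {a<..<b} x"
      using AE_lborel_singleton[of a] AE_lborel_singleton[of b]
      by eventually_elim (auto split: split_indicator)
  qed
  then have le: "(\<integral>\<^sup>+x. ennreal (norm (?f x)) \<partial>lborel) \<le> ennreal K" using nn by simp
  then have fin: "(\<integral>\<^sup>+x. ennreal (norm (?f x)) \<partial>lborel) < \<infinity>"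
    by (rule le_less_trans) simp
  have fi: "integrable lborel ?f" by (rule integrableI_bounded) (use fin in auto)
  have fL: "integrable lebesgue ?f" using fi by (subst integrable_completion) auto
  have "set_integrable lebesgue {a..b} (\<lambda>x. v x - c)" using fL unfolding set_integrable_def .
  from set_integral_add(1)[OF this set_integrable_const_Icc[of a b c]]
  show "set_integrable lebesgue {a..b} v" by simp
  have "(LINT x:{a..b}|lebesgue. \<bar>v x - c\<bar>) = (LINT x|lebesgue. norm (?f x))"
    unfolding set_lebesgue_integral_def by (intro Bochner_Integration.integral_cong) (auto simp: abs_mult)
  also have "\<dots> = (LINT x|lborel. norm (?f x))" by (rule integral_completion) measurable
  also have "\<dots> \<le> K"
  proof -
    have "ennreal (LINT x|lborel. norm (?f x)) = (\<integral>\<^sup>+x. ennreal (norm (?f x)) \<partial>lborel)"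
      using integrable_norm[OF fi] by (intro nn_integral_eq_integral[symmetric]) auto
    then have "ennreal (LINT x|lborel. norm (?f x)) \<le> ennreal K" using le by simp
    then show ?thesis using K by (simp add: ennreal_le_iff)
  qed
  finally show "(LINT x:{a..b}|lebesgue. \<bar>v x - c\<bar>) \<le> K" .
qed

text \<open>The exceptional set of the composed property lies in the image under the inverse of a
  null set, and Lusin's property (N) for the inverse makes this null.\<close>

lemma AE_comp_homeo:
  assumes h: "increasing_homeo h" and ac: "locally_abs_continuous (inv_into UNIV h)"
    and P: "AE y in lborel. P y"
  shows "AE x in lborel. P (h x)"
proof -
  obtain N where N: "N \<in> null_sets lborel" "{y. \<not> P y} \<subseteq> N"
    using P by (auto elim!: AE_E simp: null_sets_def)
  let ?k = "inv_into UNIV h"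
  have "?k ` N \<in> null_sets lborel"
    by (rule abs_continuous_image_null[OF increasing_homeo_inv(1)[OF h] ac N(1)])
  then have "AE x in lborel. x \<notin> ?k ` N" by (rule AE_not_in)
  then show ?thesis
  proof (rule AE_mp, intro AE_I2 impI)
    fix x assume "x \<notin> ?k ` N"
    then have "h x \<notin> N" using increasing_homeoD(6)[OF h, of x] by (metis imageI)
    then show "P (h x)" using N(2) by auto
  qed
qed

lemma deviation_level_set:
  fixes v :: "real \<Rightarrow> real"
  assumes ab: "a < b" and v[measurable]: "v \<in> borel_measurable borel" and vi: "set_integrable lebesgue {a..b} v"
    and l: "0 < l"
  shows "measure lborel {x \<in> {a<..<b}. \<bar>v x - interval_mean v a b\<bar> > l} \<le> mean_oscillation v a b * (b - a) / l"
proof -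
  let ?m = "interval_mean v a b"
  let ?F = "{x \<in> {a<..<b}. \<bar>v x - ?m\<bar> > l}"
  have Fb: "?F \<in> sets borel" by measurable
  have fF: "?F \<in> fmeasurable lborel"
    by (rule fmeasurable_lborel_bounded[OF Fb, of a b]) auto
  have "integrable lebesgue (\<lambda>x. indicator ?F x * l)"
  proof -
    have "emeasure lebesgue ?F < \<infinity>" using fF Fb by (simp add: fmeasurable_def)
    then show ?thesis using Fb by (intro integrable_mult_left integrable_real_indicator) auto
  qed
  then have "(LINT x|lebesgue. indicator ?F x * l) \<le> (LINT x|lebesgue. indicator {a..b} x *\<^sub>R \<bar>v x - ?m\<bar>)"
    using set_integrable_abs_diff_const(2)[OF vi, of ?m] unfolding set_integrable_def
    by (intro integral_mono) (auto split: split_indicator)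
  also have "\<dots> = mean_oscillation v a b * (b - a)"
    using mean_oscillation_integral[OF ab, of v] unfolding set_lebesgue_integral_def by simp
  also have "(LINT x|lebesgue. indicator ?F x * l) = measure lborel ?F * l"
    using Fb by (simp add: measure_completion)
  finally show ?thesis using l by (simp add: le_divide_eq)
qed

text \<open>\<open>K\<close> depends on \<open>h\<close> alone. The length bound \<open>r\<close> is
  free so that one estimate serves twice: with \<open>r\<close> as large as desired for bounded mean
  oscillation, and with small \<open>r\<close> and \<open>e\<close> for its vanishing.\<close>

lemma mean_oscillation_comp:
  assumes h: "A_infinity_homeo h"
  obtains K where "0 < K"
    "\<forall>v r e. v \<in> borel_measurable borel \<and> (\<forall>a b. set_integrable lebesgue {a..b} v) \<and> 0 < e \<and>
      (\<forall>a b. a < b \<and> b - a \<le> r \<longrightarrow> mean_oscillation v (h a) (h b) \<le> e) \<longrightarrow>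
      (\<forall>a b. a < b \<and> b - a \<le> r \<longrightarrow> set_integrable lebesgue {a..b} (\<lambda>x. v (h x)) \<and>
        mean_oscillation (\<lambda>x. v (h x)) a b \<le> K * e)"
proof -
  let ?k = "inv_into UNIV h"
  have hi: "increasing_homeo h" using h by (simp add: A_infinity_homeo_def)
  have ki: "increasing_homeo ?k" using increasing_homeo_inv[OF hi] by auto
  note D = increasing_homeoD[OF hi]
  obtain C \<alpha> where C: "0 < C" "0 < \<alpha>" and C_le: "\<forall>a b E. a < b \<and> E \<in> sets borel \<and> E \<subseteq> {a..b} \<longrightarrow>
    measure lborel (?k ` E) \<le> C * (?k b - ?k a) * (measure lborel E / (b - a)) powr \<alpha>"
    by (rule A_infinity_homeoE[OF A_infinity_homeo_inv[OF h]])
  \<comment> \<open>A subset of \<open>h(I)\<close> with relative measure at most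
    \<open>\<gamma>\<close> pulls back to at most 1/16 of \<open>I\<close>, the share that
    John-Nirenberg requires.\<close>
  define \<gamma> where "\<gamma> = (1 / (16 * C)) powr (1 / \<alpha>)"
  have \<gamma>: "\<gamma> > 0" using C by (simp add: \<gamma>_def)
  have C\<gamma>: "C * \<gamma> powr \<alpha> = 1 / 16" using C by (simp add: \<gamma>_def powr_powr)
  have main: "set_integrable lebesgue {a..b} (\<lambda>x. v (h x)) \<and> mean_oscillation (\<lambda>x. v (h x)) a b \<le> 4 / \<gamma> * e"
    if v: "v \<in> borel_measurable borel" and vi: "\<And>a b. set_integrable lebesgue {a..b} v" and e: "0 < e"
      and osc: "\<And>a b. a < b \<Longrightarrow> b - a \<le> r \<Longrightarrow> mean_oscillation v (h a) (h b) \<le> e"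
      and ab: "a < b" "b - a \<le> r" for v r e a b
  proof -
    \<comment> \<open>At this threshold Chebyshev's inequality yields the share
      \<open>\<gamma>\<close>. John-Nirenberg turns \<open>l\<close> into a deviation of
      \<open>2 * l\<close>, and passing to the mean doubles it again, whence
      \<open>4 / \<gamma>\<close>.\<close>
    define l where "l = e / \<gamma>"
    have l: "l > 0" using e \<gamma> by (simp add: l_def)
    define c where "c a b = interval_mean v (h a) (h b)" for a b
    have hm: "h \<in> borel_measurable borel" by (rule borel_measurable_continuous_onI[OF D(3)])
    have vh: "(\<lambda>x. v (h x)) \<in> borel_measurable borel" using measurable_compose[OF hm v] .
    have base: "measure lborel {x \<in> {a<..<b}. \<bar>v (h x) - c a b\<bar> > l} \<le> (b - a) / 16"
      if ab: "a < b" "b - a \<le> r" for a b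
    proof -
      have hab: "h a < h b" using ab(1) increasing_homeo_less_iff[OF hi] by simp
      let ?F = "{y \<in> {h a<..<h b}. \<bar>v y - c a b\<bar> > l}"
      have Fb: "?F \<in> sets borel" using v by measurable
      have "measure lborel ?F \<le> mean_oscillation v (h a) (h b) * (h b - h a) / l"
        unfolding c_def by (rule deviation_level_set[OF hab v vi l])
      also have "\<dots> \<le> e * (h b - h a) / l"
        using osc[OF ab] hab l by (intro divide_right_mono mult_right_mono) auto
      also have "\<dots> = \<gamma> * (h b - h a)" using e \<gamma> by (simp add: l_def)
      finally have F\<gamma>: "measure lborel ?F / (h b - h a) \<le> \<gamma>" using hab by (simp add: divide_le_eq)
      have pre: "h a < h b \<and> ?F \<in> sets borel \<and> ?F \<subseteq> {h a..h b}"
        by (intro conjI hab Fb) (simp add: subset_eq)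
      have set_eq: "{x \<in> {a<..<b}. \<bar>v (h x) - c a b\<bar> > l} = ?k ` ?F"
      proof
        show "{x \<in> {a<..<b}. \<bar>v (h x) - c a b\<bar> > l} \<subseteq> ?k ` ?F"
        proof
          fix x assume "x \<in> {x \<in> {a<..<b}. \<bar>v (h x) - c a b\<bar> > l}"
          then have "h x \<in> ?F" using increasing_homeo_less_iff[OF hi] by simp
          then show "x \<in> ?k ` ?F" by (intro image_eqI[of x ?k "h x"]) (simp_all add: D(6))
        qed
        show "?k ` ?F \<subseteq> {x \<in> {a<..<b}. \<bar>v (h x) - c a b\<bar> > l}"
        proof
          fix x assume "x \<in> ?k ` ?F"
          then obtain y where y: "y \<in> ?F" "x = ?k y" by blast
          then have "h x = y" using D(5) by simp
          then show "x \<in> {x \<in> {a<..<b}. \<bar>v (h x) - c a b\<bar> > l}"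
            using y(1) increasing_homeo_less_iff[OF hi] by force
        qed
      qed
      have "measure lborel (?k ` ?F) \<le> C * (?k (h b) - ?k (h a)) * (measure lborel ?F / (h b - h a)) powr \<alpha>"
        by (rule C_le[rule_format, OF pre])
      also have "\<dots> \<le> C * (b - a) * \<gamma> powr \<alpha>"
        unfolding D(6) using C ab F\<gamma> hab by (intro mult_left_mono powr_mono2) auto
      also have "\<dots> = (b - a) / 16" using C\<gamma> by (simp add: mult_ac)
      finally show ?thesis unfolding set_eq .
    qed
    have nn: "(\<integral>\<^sup>+x. ennreal \<bar>v (h x) - c a b\<bar> * indicator {a<..<b} x \<partial>lborel) \<le> ennreal (2 * l * (b - a))"
      by (rule john_nirenberg_integral[OF vh l base ab])
    have K: "0 \<le> 2 * l * (b - a)" using l ab by simp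
    note I = set_integral_le_of_nn_integral[OF vh K nn]
    have "mean_oscillation (\<lambda>x. v (h x)) a b \<le> 2 * (2 * l)"
      by (rule mean_oscillation_le_of_deviation[OF ab(1) I])
    then show ?thesis using I(1) by (simp add: l_def)
  qed
  show thesis
  proof (rule that, safe)
    show "0 < 4 / \<gamma>" using \<gamma> by simp
    fix v :: "real \<Rightarrow> real" and r e a b
    assume *: "v \<in> borel_measurable borel" "\<forall>a b. set_integrable lebesgue {a..b} v" "0 < e"
      "\<forall>a b. a < b \<and> b - a \<le> r \<longrightarrow> mean_oscillation v (h a) (h b) \<le> e" "a < b" "b - a \<le> r"
    have **: "set_integrable lebesgue {a..b} (\<lambda>x. v (h x)) \<and> mean_oscillation (\<lambda>x. v (h x)) a b \<le> 4 / \<gamma> * e"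
      by (rule main[where v=v and e=e and r=r]) (use * in simp_all)
    show "set_integrable lebesgue {a..b} (\<lambda>x. v (h x))" "mean_oscillation (\<lambda>x. v (h x)) a b \<le> 4 / \<gamma> * e"
      using ** by simp_all
  qed
qed

lemma VMO_comp:
  assumes u: "u \<in> VMO" and h: "A_infinity_homeo h" and uc: "uniformly_continuous_on UNIV h"
  shows "(\<lambda>x. u (h x)) \<in> VMO"
proof -
  have hi: "increasing_homeo h" using h by (simp add: A_infinity_homeo_def)
  have "u \<in> borel_measurable lebesgue"
  proof -
    have "(\<lambda>x. indicator {- real n..real n} x *\<^sub>R u x) \<in> borel_measurable lebesgue" for n
      using u unfolding VMO_iff set_integrable_def by (blast intro: borel_measurable_integrable)
    then show ?thesis
    proof (rule borel_measurable_LIMSEQ_real[rotated])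
      fix x :: real
      obtain N :: nat where N: "\<bar>x\<bar> < real N" using reals_Archimedean2 by blast
      show "(\<lambda>n. indicator {- real n..real n} x *\<^sub>R u x) \<longlonglongrightarrow> u x"
      proof (rule tendsto_eventually, rule eventually_sequentiallyI[of N])
        fix n assume "N \<le> n"
        then have "x \<in> {- real n..real n}" using N by auto
        then show "indicator {- real n..real n} x *\<^sub>R u x = u x" by simp
      qed
    qed
  qed
  \<comment> \<open>The level-set arguments need a Borel function, so \<open>u\<close> is replaced
    by a Borel version. The way back at the end rests on absolute continuity of the inverse, which
    keeps the exceptional set null after composition.\<close>
  then obtain v where v: "v \<in> borel_measurable lborel" and uv: "AE x in lborel. u x = v x"
    using completion_ex_borel_measurable_real by blast
  have vb: "v \<in> borel_measurable borel" using v by simp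
  have vV: "v \<in> VMO" by (rule VMO_cong_AE[OF u AE_completion[OF uv]])
  have vi: "set_integrable lebesgue {a..b} v" for a b using vV by (simp add: VMO_iff)
  obtain K where K: "0 < K" and comp:
    "\<forall>v r e. v \<in> borel_measurable borel \<and> (\<forall>a b. set_integrable lebesgue {a..b} v) \<and> 0 < e \<and>
      (\<forall>a b. a < b \<and> b - a \<le> r \<longrightarrow> mean_oscillation v (h a) (h b) \<le> e) \<longrightarrow>
      (\<forall>a b. a < b \<and> b - a \<le> r \<longrightarrow> set_integrable lebesgue {a..b} (\<lambda>x. v (h x)) \<and>
        mean_oscillation (\<lambda>x. v (h x)) a b \<le> K * e)"
    by (rule mean_oscillation_comp[OF h])
  obtain B where B: "\<And>a b. a < b \<Longrightarrow> mean_oscillation v a b \<le> B" using vV unfolding VMO_iff by blast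
  have hab: "h a < h b" if "a < b" for a b using that increasing_homeo_less_iff[OF hi] by simp
  have bounded: "set_integrable lebesgue {a..b} (\<lambda>x. v (h x)) \<and> mean_oscillation (\<lambda>x. v (h x)) a b \<le> K * (\<bar>B\<bar> + 1)"
    if "a < b" for a b
  proof -
    \<comment> \<open>A bound that is certainly positive, as \<open>comp\<close> demands.\<close>
    have "mean_oscillation v (h p) (h q) \<le> \<bar>B\<bar> + 1" if "p < q" for p q
      using B[OF hab[OF that]] by simp
    then show ?thesis using comp[rule_format, of v "\<bar>B\<bar> + 1" "b - a" a b] vb vi that by simp
  qed
  have "(\<lambda>x. v (h x)) \<in> VMO"
    unfolding VMO_iff
  proof (intro conjI allI impI)
    show "set_integrable lebesgue {a..b} (\<lambda>x. v (h x))" for a b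
    proof (rule set_integrable_subset)
      \<comment> \<open>Enlarged because \<open>bounded\<close> concerns nondegenerate intervals
        only.\<close>
      show "set_integrable lebesgue {a..max b (a+1)} (\<lambda>x. v (h x))"
        using bounded[of a "max b (a+1)"] by simp
    qed auto
    show "\<exists>B. \<forall>a b. a < b \<longrightarrow> mean_oscillation (\<lambda>x. v (h x)) a b \<le> B" using bounded by blast
    fix e :: real assume e: "0 < e"
    have e': "0 < e / (2 * K)" using e K by simp
    obtain d where d: "d > 0" "\<And>a b. a < b \<Longrightarrow> b - a < d \<Longrightarrow> mean_oscillation v a b < e / (2 * K)"
      using vV e' unfolding VMO_iff by meson
    obtain r where r: "r > 0" "\<And>x y. dist y x < r \<Longrightarrow> dist (h y) (h x) < d"
      using uc d(1) unfolding uniformly_continuous_on_def by auto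
    have small: "mean_oscillation v (h p) (h q) \<le> e / (2 * K)" if "p < q" "q - p \<le> r / 2" for p q
    proof -
      have "dist (h q) (h p) < d" using r that by (intro r(2)) (simp add: dist_real_def)
      then have "h q - h p < d" by (simp add: dist_real_def)
      then show ?thesis using d(2)[OF hab[OF that(1)]] by simp
    qed
    have *: "mean_oscillation (\<lambda>x. v (h x)) a b \<le> K * (e / (2 * K))" if "a < b" "b - a \<le> r / 2" for a b
      using comp[rule_format, of v "e / (2 * K)" "r / 2" a b] vb vi e' small that by simp
    have "mean_oscillation (\<lambda>x. v (h x)) a b < e" if "a < b" "b - a < r / 2" for a b
    proof -
      have "mean_oscillation (\<lambda>x. v (h x)) a b \<le> K * (e / (2 * K))" using * that by simp
      also have "\<dots> = e / 2" using K by simp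
      finally show ?thesis using e by simp
    qed
    then show "\<exists>d>0. \<forall>a b. a < b \<and> b - a < d \<longrightarrow> mean_oscillation (\<lambda>x. v (h x)) a b < e"
      using r(1) by (intro exI[of _ "r / 2"]) auto
  qed
  moreover have "AE x in lebesgue. v (h x) = u (h x)"
  proof (rule AE_completion, rule AE_comp_homeo[OF hi])
    show "locally_abs_continuous (inv_into UNIV h)"
      by (rule A_infinity_homeo_abs_continuous[OF A_infinity_homeo_inv[OF h]])
    show "AE y in lborel. v y = u y" using uv by (rule AE_mp) (auto intro!: AE_I2)
  qed
  ultimately show ?thesis by (rule VMO_cong_AE)
qed

section \<open>Logarithmic derivatives\<close>

lemma SQS_iff_A_infinity_homeo: "h \<in> SQS \<longleftrightarrow> A_infinity_homeo h"
  using SQS_imp_A_infinity_homeo A_infinity_homeo_imp_SQS by blast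

text \<open>The zero set of the derivative has an image of length 0, and the inverse is absolutely
  continuous too, so it carries this image back to a null set. Positivity is what lets logarithms of
  products split.\<close>

lemma ae_deriv_pos:
  assumes A: "A_infinity_homeo h"
  shows "AE x in lborel. 0 < ae_deriv h x"
proof -
  let ?k = "inv_into UNIV h"
  have h: "increasing_homeo h" using A by (simp add: A_infinity_homeo_def)
  note ac = A_infinity_homeo_abs_continuous[OF A]
  note kac = A_infinity_homeo_abs_continuous[OF A_infinity_homeo_inv[OF A]]
  have "AE x in lborel. x \<in> {- real n..real n} \<longrightarrow> ae_deriv h x \<noteq> 0" for n :: nat
  proof -
    let ?Z = "{x \<in> {- real n..real n}. ae_deriv h x = 0}"
    have "?Z = ae_deriv h -` {0} \<inter> space lebesgue \<inter> {- real n..real n}" by auto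
    also have "\<dots> \<in> sets lebesgue"
      by (intro sets.Int measurable_sets[OF ae_deriv_measurable[OF h ac]]) auto
    finally have "?Z \<in> sets lebesgue" .
    then obtain F where F: "F \<in> sets borel" "F \<subseteq> ?Z" and FZ: "AE x in lebesgue. x \<in> F \<longleftrightarrow> x \<in> ?Z"
      by (rule lebesgue_set_borel_part)
    have Fn: "F \<subseteq> {- real n..real n}" using F(2) by auto
    have "measure lborel (h ` F) = (LINT x:F|lebesgue. ae_deriv h x)"
      by (rule ae_deriv_integral[OF h ac F(1) Fn, symmetric])
    also have "\<dots> = (LINT x:F|lebesgue. 0)"
      unfolding set_lebesgue_integral_def
      by (intro Bochner_Integration.integral_cong) (use F(2) in \<open>auto split: split_indicator\<close>)
    also have "\<dots> = 0" by (simp add: set_lebesgue_integral_def)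
    finally have "emeasure lborel (h ` F) = 0"
      using emeasure_eq_measure2[OF fmeasurable_image[OF h F(1) Fn]] by simp
    then have "h ` F \<in> null_sets lborel" using borel_image[OF h F(1)] by (simp add: null_sets_def)
    then have "?k ` (h ` F) \<in> null_sets lborel"
      by (rule abs_continuous_image_null[OF increasing_homeo_inv(1)[OF h] kac])
    also have "?k ` (h ` F) = F" using increasing_homeoD(6)[OF h] by (simp add: image_image)
    finally have "AE x in lborel. x \<notin> F" by (rule AE_not_in)
    moreover have "AE x in lborel. x \<in> F \<longleftrightarrow> x \<in> ?Z" using FZ by (simp add: AE_completion_iff)
    ultimately show ?thesis by eventually_elim auto
  qed
  then have "AE x in lborel. ae_deriv h x \<noteq> 0" by (rule AE_lborel_bounded)
  then show ?thesis
  proof eventually_elim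
    fix x assume "ae_deriv h x \<noteq> 0"
    then show "0 < ae_deriv h x" using ae_deriv_nonneg[OF h, of x] by simp
  qed
qed

text \<open>The chain rule holds at points where \<open>h\<close> is differentiable and
  \<open>g\<close> is differentiable at \<open>h x\<close>. That the second condition excludes only
  a null set of \<open>x\<close> is due to \<open>AE_comp_homeo\<close>.\<close>

lemma ln_ae_deriv_comp:
  assumes g: "A_infinity_homeo g" and h: "A_infinity_homeo h"
  shows "AE x in lborel. ln (ae_deriv (g \<circ> h) x) = ln (ae_deriv g (h x)) + ln (ae_deriv h x)"
proof -
  have gi: "increasing_homeo g" and hi: "increasing_homeo h"
    using g h by (auto simp: A_infinity_homeo_def)
  note gac = A_infinity_homeo_abs_continuous[OF g] and hac = A_infinity_homeo_abs_continuous[OF h]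
  note kac = A_infinity_homeo_abs_continuous[OF A_infinity_homeo_inv[OF h]]
  show ?thesis
    using ae_has_deriv[OF hi hac] ae_deriv_pos[OF h]
      AE_comp_homeo[OF hi kac ae_has_deriv[OF gi gac]] AE_comp_homeo[OF hi kac ae_deriv_pos[OF g]]
  proof eventually_elim
    fix x
    assume dh: "(h has_real_derivative ae_deriv h x) (at x)" and ph: "0 < ae_deriv h x"
      and dg: "(g has_real_derivative ae_deriv g (h x)) (at (h x))" and pg: "0 < ae_deriv g (h x)"
    have "(g \<circ> h has_real_derivative ae_deriv g (h x) * ae_deriv h x) (at x)"
      using dg dh by (rule DERIV_chain)
    then have "ae_deriv (g \<circ> h) x = ae_deriv g (h x) * ae_deriv h x" by (rule ae_deriv_eq)
    then show "ln (ae_deriv (g \<circ> h) x) = ln (ae_deriv g (h x)) + ln (ae_deriv h x)"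
      using ph pg by (simp add: ln_mult)
  qed
qed

lemma ln_ae_deriv_inv:
  assumes h: "A_infinity_homeo h"
  shows "AE y in lborel. ln (ae_deriv (inv_into UNIV h) y) = - ln (ae_deriv h (inv_into UNIV h y))"
proof -
  let ?k = "inv_into UNIV h"
  have hi: "increasing_homeo h" using h by (simp add: A_infinity_homeo_def)
  have ki: "increasing_homeo ?k" and kk: "inv_into UNIV ?k = h" using increasing_homeo_inv[OF hi] by auto
  note D = increasing_homeoD[OF hi]
  note hac = A_infinity_homeo_abs_continuous[OF h]
  have hac': "locally_abs_continuous (inv_into UNIV ?k)" using hac kk by simp
  show ?thesis
    using AE_comp_homeo[OF ki hac' ae_has_deriv[OF hi hac]] AE_comp_homeo[OF ki hac' ae_deriv_pos[OF h]]
  proof eventually_elim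
    fix y
    assume d: "(h has_real_derivative ae_deriv h (?k y)) (at (?k y))" and p: "0 < ae_deriv h (?k y)"
    have "(?k has_real_derivative inverse (ae_deriv h (?k y))) (at y)"
    \<comment> \<open>Any open interval around \<open>y\<close> would serve, since the inverse
      relation holds on the whole line.\<close>
    proof (rule DERIV_inverse_function[where f=h and g="inv_into UNIV h" and x=y and a="y - 1" and b="y + 1", OF d])
      show "isCont ?k y" using D(4) by (simp add: continuous_on_eq_continuous_at)
    qed (use p D(5) in auto)
    then have "ae_deriv ?k y = inverse (ae_deriv h (?k y))" by (rule ae_deriv_eq)
    then show "ln (ae_deriv ?k y) = - ln (ae_deriv h (?k y))" using p by (simp add: ln_inverse)
  qed
qed

section \<open>The class SS and the subgroup\<close>

lemma SS_iff: "h \<in> SS \<longleftrightarrow> A_infinity_homeo h \<and> (\<lambda>x. ln (ae_deriv h x)) \<in> VMO"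
  by (simp add: SS_def SQS_iff_A_infinity_homeo)

lemma SS_inv:
  assumes h: "h \<in> SS" and uc: "uniformly_continuous_on UNIV (inv_into UNIV h)"
  shows "inv_into UNIV h \<in> SS"
proof -
  have A: "A_infinity_homeo h" and V: "(\<lambda>x. ln (ae_deriv h x)) \<in> VMO" using h by (auto simp: SS_iff)
  note kA = A_infinity_homeo_inv[OF A]
  have "(\<lambda>y. - ln (ae_deriv h (inv_into UNIV h y))) \<in> VMO"
    by (rule VMO_uminus[OF VMO_comp[OF V kA uc]])
  moreover have "AE y in lebesgue. - ln (ae_deriv h (inv_into UNIV h y)) = ln (ae_deriv (inv_into UNIV h) y)"
    using AE_completion[OF ln_ae_deriv_inv[OF A]] by eventually_elim simp
  ultimately have "(\<lambda>y. ln (ae_deriv (inv_into UNIV h) y)) \<in> VMO" by (rule VMO_cong_AE)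
  then show ?thesis using kA by (simp add: SS_iff)
qed

lemma SS_comp:
  assumes g: "g \<in> SS" and h: "h \<in> SS" and uc: "uniformly_continuous_on UNIV h"
  shows "g \<circ> h \<in> SS"
proof -
  have gA: "A_infinity_homeo g" and gV: "(\<lambda>x. ln (ae_deriv g x)) \<in> VMO" using g by (auto simp: SS_iff)
  have hA: "A_infinity_homeo h" and hV: "(\<lambda>x. ln (ae_deriv h x)) \<in> VMO" using h by (auto simp: SS_iff)
  have "(\<lambda>x. ln (ae_deriv g (h x)) + ln (ae_deriv h x)) \<in> VMO"
    by (rule VMO_add[OF VMO_comp[OF gV hA uc] hV])
  moreover have "AE x in lebesgue. ln (ae_deriv g (h x)) + ln (ae_deriv h x) = ln (ae_deriv (g \<circ> h) x)"
    using AE_completion[OF ln_ae_deriv_comp[OF gA hA]] by eventually_elim simp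
  ultimately have "(\<lambda>x. ln (ae_deriv (g \<circ> h) x)) \<in> VMO" by (rule VMO_cong_AE)
  then show ?thesis using A_infinity_homeo_comp[OF gA hA] by (simp add: SS_iff)
qed

lemma SS_id: "id \<in> SS"
proof -
  have "ae_deriv id x = 1" for x by (rule ae_deriv_eq) (simp add: id_def)
  then show ?thesis by (simp add: SS_iff A_infinity_homeo_id VMO_zero)
qed

text \<open>\<open>m_inv\<close> is a definite description over the carrier. It denotes the inverse
  function because that function lies in \<open>SQS\<close> and two-sided inverses are
  unique.\<close>

lemma SQS_group_inv:
  assumes h: "h \<in> SQS"
  shows "m_inv SQS_group h = inv_into UNIV h"
proof -
  have A: "A_infinity_homeo h" using h by (simp add: SQS_iff_A_infinity_homeo)
  have hi: "increasing_homeo h" using A by (simp add: A_infinity_homeo_def)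
  note D = increasing_homeoD[OF hi]
  have kS: "inv_into UNIV h \<in> SQS" using A_infinity_homeo_inv[OF A] by (simp add: SQS_iff_A_infinity_homeo)
  show ?thesis
    unfolding m_inv_def SQS_group_def
  proof (simp, rule the_equality)
    show "inv_into UNIV h \<in> SQS \<and> h \<circ> inv_into UNIV h = id \<and> inv_into UNIV h \<circ> h = id"
      using kS D(5,6) by (auto simp: fun_eq_iff)
    fix y assume y: "y \<in> SQS \<and> h \<circ> y = id \<and> y \<circ> h = id"
    show "y = inv_into UNIV h"
    proof
      fix x
      have "h (y x) = x" using y by (metis comp_apply id_apply)
      then show "y x = inv_into UNIV h x" using D(6)[of "y x"] by simp
    qed
  qed
qed

theorem corollary10:
  shows
    "(\<forall>h. h \<in> SS \<and> uniformly_continuous_on UNIV (inv_into UNIV h) \<longrightarrow> inv_into UNIV h \<in> SS) \<and>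
     (\<forall>g h. g \<in> SS \<and> h \<in> SS \<and> uniformly_continuous_on UNIV h \<and>
        uniformly_continuous_on UNIV (inv_into UNIV h) \<longrightarrow> g \<circ> h \<in> SS) \<and>
     subgroup {h \<in> SS. uniformly_continuous_on UNIV h \<and>
        uniformly_continuous_on UNIV (inv_into UNIV h)} SQS_group"
proof (intro conjI allI impI)
  let ?H = "{h \<in> SS. uniformly_continuous_on UNIV h \<and> uniformly_continuous_on UNIV (inv_into UNIV h)}"
  show "inv_into UNIV h \<in> SS" if "h \<in> SS \<and> uniformly_continuous_on UNIV (inv_into UNIV h)" for h
    using that SS_inv by blast
  show "g \<circ> h \<in> SS" if "g \<in> SS \<and> h \<in> SS \<and> uniformly_continuous_on UNIV h \<and>
        uniformly_continuous_on UNIV (inv_into UNIV h)" for g h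
    using that SS_comp by blast
  have homeo: "increasing_homeo h" if "h \<in> SS" for h
    using that by (simp add: SS_def SQS_def)
  have ucomp: "uniformly_continuous_on UNIV (f \<circ> g)"
    if "uniformly_continuous_on UNIV f" "uniformly_continuous_on UNIV g" for f g :: "real \<Rightarrow> real"
    using that unfolding uniformly_continuous_on_def by simp meson
  show "subgroup ?H SQS_group"
  proof
    show "?H \<subseteq> carrier SQS_group" by (auto simp: SQS_group_def SS_def)
    show "x \<otimes>\<^bsub>SQS_group\<^esub> y \<in> ?H" if x: "x \<in> ?H" and y: "y \<in> ?H" for x y
    proof -
      have "inv_into UNIV (x \<circ> y) = inv_into UNIV y \<circ> inv_into UNIV x"
        by (rule increasing_homeo_comp(2)) (use homeo x y in auto)
      then show ?thesis using x y SS_comp[of x y] ucomp by (simp add: SQS_group_def)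
    qed
    have "inv_into UNIV id = (id :: real \<Rightarrow> real)" by (rule inv_id)
    then show "\<one>\<^bsub>SQS_group\<^esub> \<in> ?H"
      using SS_id by (simp add: SQS_group_def uniformly_continuous_on_id id_def)
    show "m_inv SQS_group x \<in> ?H" if x: "x \<in> ?H" for x
    proof -
      have "x \<in> SQS" using x by (simp add: SS_def)
      moreover have "inv_into UNIV (inv_into UNIV x) = x"
        by (rule increasing_homeo_inv(2)) (use homeo x in auto)
      ultimately show ?thesis using x SS_inv[of x] by (simp add: SQS_group_inv)
    qed
  qed
qed

end
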